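(* Let $N\geq 1$ be an integer and let $k,l\in\mathbb{R}$ satisfy $k+N-1>0$ and $l+N>0$. A necessary condition for $$C_{k,l,N}=C_{k,l,N}^{rad}$$ is $$l+1\leq k+\frac{N-1}{k+N-1}.$$
   Context: $d\mu_l(x)=|x|^l\,dx$ on $\mathbb{R}^N$, and $\omega_N$ is the Lebesgue measure of the unit ball. The $\mu_k$-perimeter of a measurable set $M\subset\mathbb{R}^N$ is $$P_{\mu_k}(M):=\sup\left\{\int_M \mathrm{div}(|x|^k\mathbf{v})\,dx:\ \mathbf{v}\in C_0^1(\mathbb{R}^N,\mathbb{R}^N),\ |\mathbf{v}|\leq 1 \text{ in } M\right\}.$$ For measurable $M$ with $0<\mu_l(M)<+\infty$ set $$\mathcal{R}_{k,l,N}(M):=\frac{P_{\mu_k}(M)}{(\mu_l(M))^{(k+N-1)/(l+N)}},$$ and $C_{k,l,N}:=\inf\{\mathcal{R}_{k,l,N}(M): M \text{ measurable},\ 0<\mu_l(M)<+\infty\}$. Further $$C_{k,l,N}^{rad}:=(N\omega_N)^{(l-k+1)/(l+N)}(l+N)^{(k+N-1)/(l+N)},$$ which is the value of $\mathcal{R}_{k,l,N}$ on the unit ball centered at the origin. *)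

theory Defs
  imports "HOL-Analysis.Analysis"
begin

text \<open>The dimension \<open>N \<ge> 1\<close> is \<open>CARD('n)\<close>. Isabelle sets \<open>0 powr a = 0\<close> for every \<open>a\<close>, so
  \<open>norm x powr a\<close> differs from the weight of the mathematical text at most at the origin, which is a
  Lebesgue null set.\<close>

definition mu :: "real \<Rightarrow> (real ^ 'n::finite) measure" where
  "mu l = density lebesgue (\<lambda>x. ennreal (norm x powr l))"

definition divergence :: "(real ^ 'n::finite \<Rightarrow> real ^ 'n) \<Rightarrow> real ^ 'n \<Rightarrow> real" where
  "divergence F x = (\<Sum>i\<in>UNIV. frechet_derivative F (at x) (axis i 1) $ i)"

text \<open>Continuously differentiable vector fields with compact support.\<close>

definition C1_compact_support :: "(real ^ 'n::finite \<Rightarrow> real ^ 'n) \<Rightarrow> bool" where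
  "C1_compact_support v \<longleftrightarrow>
     (\<exists>v' :: real ^ 'n \<Rightarrow> (real ^ 'n) \<Rightarrow>\<^sub>L (real ^ 'n).
        (\<forall>x. (v has_derivative blinfun_apply (v' x)) (at x)) \<and> continuous_on UNIV v') \<and>
     compact (closure {x. v x \<noteq> 0})"

text \<open>The divergence of \<open>|x|\<^sup>k v\<close> is taken classically at \<open>x \<noteq> 0\<close>; it is \<open>O(|x|\<^sup>k\<^sup>-\<^sup>1)\<close>
  at the origin, so the integral below converges absolutely whenever \<open>k + N - 1 > 0\<close>.
  The supremum may be infinite.\<close>

definition weighted_perimeter :: "real \<Rightarrow> (real ^ 'n::finite) set \<Rightarrow> ereal" where
  "weighted_perimeter k M =
     (SUP v \<in> {v :: real ^ 'n \<Rightarrow> real ^ 'n. C1_compact_support v \<and> (\<forall>x\<in>M. norm (v x) \<le> 1)}.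
        ereal (LINT x:M|lebesgue. divergence (\<lambda>y. (norm y powr k) *\<^sub>R v y) x))"

definition isoperimetric_ratio :: "real \<Rightarrow> real \<Rightarrow> (real ^ 'n::finite) set \<Rightarrow> ereal" where
  "isoperimetric_ratio k l M =
     weighted_perimeter k M /
     ereal (measure (mu l) M powr ((k + real CARD('n) - 1) / (l + real CARD('n))))"

definition isoperimetric_const :: "'n::finite itself \<Rightarrow> real \<Rightarrow> real \<Rightarrow> ereal" where
  "isoperimetric_const _ k l =
     (INF M \<in> {M :: (real ^ 'n) set. M \<in> sets lebesgue \<and>
                 0 < emeasure (mu l) M \<and> emeasure (mu l) M < \<infinity>}.
        isoperimetric_ratio k l M)"

definition radial_const :: "'n::finite itself \<Rightarrow> real \<Rightarrow> real \<Rightarrow> real" where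
  "radial_const _ k l =
     (let N = real CARD('n); \<omega> = measure lebesgue (ball (0 :: real ^ 'n) 1)
      in (N * \<omega>) powr ((l - k + 1) / (l + N)) * (l + N) powr ((k + N - 1) / (l + N)))"

end

theory Submission
  imports Defs
begin

text \<open>The test sets are the unit balls \<open>B(t b, 1)\<close> with \<open>b\<close> a coordinate vector and \<open>t\<close> small. The
  \<open>\<mu>\<^sub>k\<close>-perimeter of a ball is at most its weighted Minkowski content, the limit of
  \<open>n \<integral>|x|\<^sup>k\<close> over the shell \<open>1 - 1/n \<le> |x - t b| < 1\<close>. Expanding \<open>|x|\<^sup>k\<close> at \<open>|x| = 1\<close>, where \<open>V\<close> is the
  volume of the unit ball, this is on average over \<open>b\<close> at most
  \<open>N V (1 + (k/2 + k(k-2)/(2N)) t\<^sup>2 + O(t\<^sup>3))\<close>. The \<open>\<mu>\<^sub>l\<close>-measure of the translated ball differs from that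
  of the centred one only through points with \<open>|x| = 1 + O(t)\<close>, so it is
  \<open>N V/(l+N) (1 + l(l+N)/(2N) t\<^sup>2 + O(t\<^sup>3))\<close>. If the centred ball is optimal, the coefficients of \<open>t\<^sup>2\<close>
  give the condition.\<close>

section \<open>Radial integrals over balls\<close>

text \<open>Optimality of the centred ball bounds the perimeter of each translated ball from below,
  so the only other estimate needed for the perimeter is one from above. It does not rest on a
  divergence theorem for balls: a test field is multiplied by a Lipschitz cutoff, and the
  derivatives of a compactly supported Lipschitz function integrate to zero because its difference
  quotients do. What remains is the gradient of the cutoff, which lives on a thin shell and has size
  \<open>n\<close> there.

  The obstacle is the origin. It lies inside every test ball, and \<open>norm x powr k\<close> and
  \<open>norm x powr l\<close> may blow up or fail to be smooth there. For the perimeter a second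
  cutoff removes it. For the measure only the symmetric difference of the translated and the centred
  ball matters, and that set stays close to the unit sphere.

  Two limits are taken in a fixed order: first the shell thickness \<open>1 / n\<close> tends to 0
  with \<open>t\<close> fixed, then \<open>t\<close> tends to 0. Hence errors in
  \<open>1 / n\<close> may be crude, while errors in \<open>t\<close> must be of third
  order.\<close>

lemma distr_norm_ball:
  fixes R :: real
  assumes R: "R \<ge> 0"
  shows "distr (density lborel (indicator (ball (0::'a::euclidean_space) R))) borel norm =
    density lborel (\<lambda>r. ennreal (DIM('a) * unit_ball_vol DIM('a) * r ^ (DIM('a) - 1)) * indicator {0..R} r)"
    (is "?M1 = ?M2")
proof (rule measure_eqI_lessThan)
  have [measurable]: "indicator (ball (0::'a) R) \<in> borel_measurable (borel :: 'a measure)"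
    "{x::'a. a < norm x} \<in> sets borel" for a
    by (auto intro!: borel_measurable_indicator)
  let ?V = "unit_ball_vol (real DIM('a))" and ?N = "DIM('a)"
  have [simp]: "?V \<ge> 0" by (rule unit_ball_vol_nonneg) simp
  show "sets ?M1 = sets borel" "sets ?M2 = sets borel" by simp_all
  \<comment> \<open>Finite measures on the line are determined by the open rays
    \<open>{a<..}\<close>. The term \<open>min R (max 0 a)\<close> clamps \<open>a\<close> to the
    range of radii: for negative \<open>a\<close> the whole ball remains, for \<open>a\<close>
    beyond \<open>R\<close> nothing does.\<close>
  have M1: "emeasure ?M1 {a<..} = ennreal (?V * R ^ ?N - ?V * (min R (max 0 a)) ^ ?N)" for a
  proof -
    have "emeasure ?M1 {a<..} = emeasure (density lborel (indicator (ball (0::'a) R))) {x. a < norm x}"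
      by (subst emeasure_distr) (auto simp: vimage_def)
    also have "\<dots> = (\<integral>\<^sup>+x. indicator (ball (0::'a) R) x * indicator {x. a < norm x} x \<partial>lborel)"
      by (rule emeasure_density) measurable
    also have "\<dots> = (\<integral>\<^sup>+x. indicator (ball (0::'a) R \<inter> {x. a < norm x}) x \<partial>lborel)"
      by (intro nn_integral_cong) (auto split: split_indicator)
    also have "\<dots> = emeasure lborel (ball (0::'a) R \<inter> {x. a < norm x})"
      by (subst nn_integral_indicator) auto
    also have "\<dots> = ennreal (?V * R ^ ?N - ?V * (min R (max 0 a)) ^ ?N)"
    proof (cases "a < 0")
      case True
      then have "ball (0::'a) R \<inter> {x. a < norm x} = ball 0 R" by (auto intro: less_le_trans)
      then show ?thesis using True R by (simp add: emeasure_ball max_def min_def)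
    next
      case False
      show ?thesis
      proof (cases "a < R")
        case aR: True
        have "ball (0::'a) R \<inter> {x. a < norm x} = ball 0 R - cball 0 a" by auto
        moreover have "emeasure lborel (ball (0::'a) R - cball 0 a) =
            emeasure lborel (ball (0::'a) R) - emeasure lborel (cball (0::'a) a)"
          using aR False by (intro emeasure_Diff) (auto simp: emeasure_cball)
        ultimately show ?thesis using False aR R
          by (simp add: emeasure_ball emeasure_cball ennreal_minus max_def min_def)
      next
        case aR: False
        then have "ball (0::'a) R \<inter> {x. a < norm x} = {}" by auto
        then show ?thesis using aR False by (simp add: max_def min_def)
      qed
    qed
    finally show ?thesis .
  qed
  show "emeasure ?M1 {a<..} < \<infinity>" for a by (simp add: M1)
  show "emeasure ?M1 {a<..} = emeasure ?M2 {a<..}" for a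
  proof -
    define b where "b = min R (max 0 a)"
    have b: "0 \<le> b" "b \<le> R" using R by (auto simp: b_def)
    have "emeasure ?M2 {a<..} =
      (\<integral>\<^sup>+r. ennreal (?N * ?V * r ^ (?N - 1)) * indicator {0..R} r * indicator {a<..} r \<partial>lborel)"
      by (subst emeasure_density) auto
    \<comment> \<open>The ray excludes its left end, the closed interval does not; the two
      integrands differ at most in the single point \<open>b\<close>.\<close>
    also have "\<dots> = (\<integral>\<^sup>+r. ennreal (?N * ?V * r ^ (?N - 1)) * indicator {b..R} r \<partial>lborel)"
      by (intro nn_integral_cong_AE, rule eventually_mono[OF AE_lborel_singleton[of b]])
         (auto simp: b_def min_def max_def split: split_indicator if_splits)
    also have "\<dots> = ennreal (?V * R ^ ?N - ?V * b ^ ?N)"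
      using b by (intro nn_integral_FTC_Icc) (auto intro!: derivative_eq_intros)
    finally show ?thesis by (simp add: M1 b_def)
  qed
qed

lemma nn_integral_norm_powr_ball:
  fixes l R :: real
  assumes R: "R \<ge> 0" and l: "l + real DIM('a) > 0"
  shows "(\<integral>\<^sup>+x. ennreal (norm x powr l) * indicator (ball (0::'a::euclidean_space) R) x \<partial>lborel) =
    ennreal (DIM('a) * unit_ball_vol DIM('a) * R powr (l + DIM('a)) / (l + DIM('a)))"
proof -
  let ?V = "unit_ball_vol (real DIM('a))" and ?N = "DIM('a)"
  have V: "?V \<ge> 0" by (rule unit_ball_vol_nonneg) simp
  have "(\<integral>\<^sup>+x. ennreal (norm x powr l) * indicator (ball (0::'a::euclidean_space) R) x \<partial>lborel) =
     (\<integral>\<^sup>+r. ennreal (r powr l) \<partial>distr (density lborel (indicator (ball (0::'a) R))) borel norm)"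
    by (subst nn_integral_distr) (auto simp: nn_integral_density borel_measurable_indicator mult.commute)
  also have "\<dots> = (\<integral>\<^sup>+r. ennreal (?N * ?V * r powr (l + ?N - 1)) * indicator {0..R} r \<partial>lborel)"
    unfolding distr_norm_ball[OF R]
  proof (subst nn_integral_density, simp_all, intro nn_integral_cong)
    fix r :: real
    \<comment> \<open>At \<open>r = 0\<close> both sides are 0 because \<open>0 powr a = 0\<close>,
      in dimension 1 as well.\<close>
    have "r \<ge> 0 \<Longrightarrow> r ^ (?N - Suc 0) * r powr l = r powr (l + ?N - 1)"
    proof (cases "r = 0")
      case False
      assume "r \<ge> 0"
      then have "r ^ (?N - Suc 0) = r powr (real ?N - 1)"
        using False DIM_positive[where 'a='a] by (simp add: powr_realpow[symmetric] of_nat_diff Suc_leI)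
      then show ?thesis by (simp add: powr_add[symmetric] algebra_simps)
    qed simp
    then show "ennreal (?N * ?V * r ^ (?N - Suc 0)) * indicator {0..R} r * ennreal (r powr l) =
      ennreal (?N * ?V * r powr (l + ?N - 1)) * indicator {0..R} r"
      by (auto split: split_indicator simp: ennreal_mult''[symmetric] mult.assoc)
  qed
  also have "\<dots> = ennreal (?N * ?V * (R powr (l + ?N - 1 + 1) / (l + ?N - 1 + 1)))"
    using l R V
    by (intro nn_integral_has_integral_lebesgue' has_integral_mult_right has_integral_powr_from_0) auto
  finally show ?thesis by simp
qed

lemma
  fixes l R :: real
  assumes R: "R \<ge> 0" and l: "l + real DIM('a) > 0"
  shows integrable_norm_powr_ball: "set_integrable lborel (ball (0::'a::euclidean_space) R) (\<lambda>x. norm x powr l)"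
    and integral_norm_powr_ball: "(LINT x:ball (0::'a) R|lborel. norm x powr l) =
      DIM('a) * unit_ball_vol DIM('a) * R powr (l + DIM('a)) / (l + DIM('a))"
proof -
  let ?c = "DIM('a) * unit_ball_vol DIM('a) * R powr (l + DIM('a)) / (l + DIM('a))"
  have "?c \<ge> 0" using l by (auto intro!: divide_nonneg_pos mult_nonneg_nonneg unit_ball_vol_nonneg)
  moreover have [measurable]: "indicat_real (ball (0::'a) R) \<in> borel_measurable borel"
    by (rule borel_measurable_indicator) simp
  ultimately have "has_bochner_integral lborel (\<lambda>x. indicat_real (ball (0::'a) R) x *\<^sub>R (norm x powr l)) ?c"
    using nn_integral_norm_powr_ball[OF R l]
    by (intro has_bochner_integral_nn_integral) 
       (auto simp: ennreal_mult ennreal_indicator borel_measurable_indicator mult.commute)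
  then show "set_integrable lborel (ball (0::'a) R) (\<lambda>x. norm x powr l)"
     "(LINT x:ball (0::'a) R|lborel. norm x powr l) = ?c"
    unfolding set_integrable_def set_lebesgue_integral_def
    by (auto simp: has_bochner_integral_iff)
qed

section \<open>Perimeter of a ball and weighted Minkowski content\<close>

lemma integral_lborel_translation:
  fixes f :: "'a::euclidean_space \<Rightarrow> 'b::{banach, second_countable_topology}"
  assumes [measurable]: "f \<in> borel_measurable borel"
  shows "(LINT x|lborel. f (c + x)) = (LINT x|lborel. f x)"
    and "integrable lborel (\<lambda>x. f (c + x)) \<longleftrightarrow> integrable lborel f"
  using integral_distr[of "(+) c" lborel borel f] integrable_distr_eq[of "(+) c" lborel borel f]
  by (simp_all add: lborel_distr_plus)

text \<open>Difference quotients of \<open>G\<close> along \<open>e\<close> have integral 0 by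
  translation invariance, and the Lipschitz bound dominates them by a multiple of the indicator of a
  ball, so the integral of the limit is 0 too. Taking \<open>g\<close> as a pointwise
  \<open>lim\<close> makes it Borel measurable without any knowledge of the derivative, and
  \<open>g\<close> still agrees with the derivative wherever that exists.\<close>

lemma integral_directional_derivative_eq_0:
  fixes G :: "'a::euclidean_space \<Rightarrow> real" and e :: 'a
  assumes lip: "C-lipschitz_on UNIV G"
    and supp: "\<And>x. R \<le> norm x \<Longrightarrow> G x = 0"
    and diff: "AE x in lborel. G differentiable at x"
  obtains g where "integrable lborel g" "(LINT x|lborel. g x) = 0"
    "\<And>x D. (G has_derivative D) (at x) \<Longrightarrow> g x = D e"
proof -
  define q where "q n x = (G (inverse (real (Suc n)) *\<^sub>R e + x) - G x) * real (Suc n)" for n x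
  define g where "g x = lim (\<lambda>n. q n x)" for x
  have "continuous_on UNIV G" using lip by (rule lipschitz_on_continuous_on)
  then have Gm [measurable]: "G \<in> borel_measurable borel" by (rule borel_measurable_continuous_onI)
  have qm [measurable]: "q n \<in> borel_measurable borel" for n unfolding q_def by measurable
  have gm [measurable]: "g \<in> borel_measurable borel" unfolding g_def by measurable
  have C: "C \<ge> 0" using lip by (rule lipschitz_on_nonneg)
  have lim: "(\<lambda>n. q n x) \<longlonglongrightarrow> D e" if "(G has_derivative D) (at x)" for x D
  proof -
    have "((\<lambda>t. G (t *\<^sub>R e + x)) has_derivative (\<lambda>t. D (t *\<^sub>R e))) (at 0)"
      by (rule has_derivative_compose[of "\<lambda>t. t *\<^sub>R e + x", OF _ has_derivative_at_withinI])
         (auto intro!: derivative_eq_intros simp: that)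
    moreover have "(\<lambda>t. D (t *\<^sub>R e)) = (*) (D e)"
      using linear_cmul[OF has_derivative_linear[OF that]] by (auto simp: mult.commute)
    ultimately have "((\<lambda>t. G (t *\<^sub>R e + x)) has_field_derivative D e) (at 0)"
      unfolding has_field_derivative_def by simp
    then have "((\<lambda>t. (G (t *\<^sub>R e + x) - G x) / t) \<longlongrightarrow> D e) (at 0)"
      by (simp add: DERIV_def)
    moreover have "filterlim (\<lambda>n. inverse (real (Suc n))) (at 0) sequentially"
      using LIMSEQ_inverse_real_of_nat by (simp add: filterlim_at)
    ultimately have "(\<lambda>n. (G (inverse (real (Suc n)) *\<^sub>R e + x) - G x) / inverse (real (Suc n))) \<longlonglongrightarrow> D e"
      by (rule filterlim_compose)
    then show ?thesis by (simp add: q_def divide_inverse)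
  qed
  have g: "g x = D e" if "(G has_derivative D) (at x)" for x D
    unfolding g_def using lim[OF that] by (rule limI)
  \<comment> \<open>The radius exceeds \<open>R\<close> by \<open>norm e\<close> because the shifted
    argument, displaced by at most \<open>norm e\<close>, may still meet the support.\<close>
  define w where "w = (\<lambda>x::'a. C * norm e * indicat_real (ball 0 (R + norm e)) x)"
  have w: "integrable lborel w"
    unfolding w_def by (intro integrable_mult_right integrable_real_indicator) (auto simp: emeasure_bounded_finite[unfolded infinity_ennreal_def])
  have bound: "norm (q n x) \<le> w x" for n x
  proof (cases "norm x < R + norm e")
    case True
    have "\<bar>G (inverse (real (Suc n)) *\<^sub>R e + x) - G x\<bar> \<le> C * norm (inverse (real (Suc n)) *\<^sub>R e)"
      using lipschitz_onD[OF lip, of "inverse (real (Suc n)) *\<^sub>R e + x" x] by (simp add: dist_norm)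
    then have "norm (q n x) \<le> C * norm (inverse (real (Suc n)) *\<^sub>R e) * real (Suc n)"
      unfolding q_def by (simp add: abs_mult mult_right_mono del: of_nat_Suc)
    also have "\<dots> = C * norm e" by simp
    finally show ?thesis using True by (simp add: w_def)
  next
    case False
    have "norm (inverse (real (Suc n)) *\<^sub>R e) \<le> 1 * norm e"
      unfolding norm_scaleR by (rule mult_right_mono) (auto simp: field_simps)
    moreover have "norm x \<le> norm (inverse (real (Suc n)) *\<^sub>R e + x) + norm (inverse (real (Suc n)) *\<^sub>R e)"
      using norm_triangle_ineq4[of "inverse (real (Suc n)) *\<^sub>R e + x" "inverse (real (Suc n)) *\<^sub>R e"] by simp
    ultimately have "R \<le> norm (inverse (real (Suc n)) *\<^sub>R e + x)" using False by linarith
    moreover have "R \<le> norm x" using False norm_ge_zero[of e] by linarith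
    ultimately show ?thesis using False by (simp add: q_def w_def supp)
  qed
  have conv: "AE x in lborel. (\<lambda>n. q n x) \<longlonglongrightarrow> g x"
    using diff by (rule eventually_mono) (auto simp: differentiable_def g dest: lim)
  have Gi: "integrable lborel G"
  proof (rule Bochner_Integration.integrable_bound)
    show "integrable lborel (\<lambda>x::'a. C * (R + R) * indicator (ball 0 R) x)"
      by (intro integrable_mult_right integrable_real_indicator) (auto simp: emeasure_bounded_finite[unfolded infinity_ennreal_def])
    show "AE x in lborel. norm (G x) \<le> norm (C * (R + R) * indicator (ball 0 R) x)"
    proof (intro AE_I2)
      fix x :: 'a
      show "norm (G x) \<le> norm (C * (R + R) * indicator (ball 0 R) x)"
      proof (cases "norm x < R")
        case True
        then have R: "R > 0" using norm_ge_zero[of x] by linarith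
        \<comment> \<open>A point at distance exactly \<open>R\<close> from the origin, where
          \<open>G\<close> vanishes; comparing \<open>G x\<close> with \<open>G y\<close> bounds
          \<open>G\<close> by its Lipschitz constant times \<open>2 * R\<close>.\<close>
        define y where "y = R *\<^sub>R (SOME b::'a. b \<in> Basis)"
        have "norm y = R" using R by (simp add: y_def norm_Basis[OF SOME_Basis])
        then have "\<bar>G x\<bar> \<le> C * norm (x - y)"
          using lipschitz_onD[OF lip, of x y] supp[of y] by (simp add: dist_norm)
        also have "\<dots> \<le> C * (R + R)"
          using norm_triangle_ineq4[of x y] True \<open>norm y = R\<close> C by (intro mult_left_mono) auto
        finally show ?thesis using True C R by simp
      qed (simp add: supp)
    qed
  qed simp
  have "integral\<^sup>L lborel (q n) = 0" for n
    unfolding q_def using Gi integral_lborel_translation[OF Gm] by simp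
  moreover have "(\<lambda>n. integral\<^sup>L lborel (q n)) \<longlonglongrightarrow> integral\<^sup>L lborel g"
    by (rule integral_dominated_convergence[where w=w]) (use w conv bound in auto)
  ultimately have "integral\<^sup>L lborel g = 0" by (simp add: LIMSEQ_const_iff)
  moreover have "integrable lborel g"
    by (rule integrable_dominated_convergence[where w=w and s=q]) (use w conv bound in auto)
  ultimately show ?thesis using g that by blast
qed

section \<open>Cutoff functions and Lipschitz bounds\<close>

text \<open>Two instances occur. \<open>radial_cutoff n (- n) z\<close> is 1 up to distance
  \<open>1 - 1 / n\<close> from \<open>z\<close> and 0 from distance 1 on;
  \<open>radial_cutoff (- 1) n 0\<close> is 0 up to distance \<open>1 / n\<close> from the origin
  and 1 from distance \<open>2 / n\<close> on.\<close>

definition radial_cutoff :: "real \<Rightarrow> real \<Rightarrow> 'a::real_inner \<Rightarrow> 'a \<Rightarrow> real" where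
  "radial_cutoff \<alpha> \<beta> z x = max 0 (min 1 (\<alpha> + \<beta> * norm (x - z)))"

lemma radial_cutoff_bounds: "0 \<le> radial_cutoff \<alpha> \<beta> z x" "radial_cutoff \<alpha> \<beta> z x \<le> 1"
  by (auto simp: radial_cutoff_def)

lemma lipschitz_radial_cutoff: "\<bar>\<beta>\<bar>-lipschitz_on UNIV (radial_cutoff \<alpha> \<beta> z)"
proof (rule lipschitz_onI)
  fix x y :: 'a
  have "dist (radial_cutoff \<alpha> \<beta> z x) (radial_cutoff \<alpha> \<beta> z y) \<le>
      \<bar>(\<alpha> + \<beta> * norm (x - z)) - (\<alpha> + \<beta> * norm (y - z))\<bar>"
    by (auto simp: radial_cutoff_def dist_real_def)
  also have "\<dots> = \<bar>\<beta>\<bar> * \<bar>norm (x - z) - norm (y - z)\<bar>"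
    by (simp add: abs_mult[symmetric] algebra_simps)
  also have "\<dots> \<le> \<bar>\<beta>\<bar> * dist x y"
    using norm_triangle_ineq3[of "x - z" "y - z"] by (intro mult_left_mono) (auto simp: dist_norm)
  finally show "dist (radial_cutoff \<alpha> \<beta> z x) (radial_cutoff \<alpha> \<beta> z y) \<le> \<bar>\<beta>\<bar> * dist x y" .
qed simp

text \<open>Away from the centre and the two clamping radii the cutoff is locally constant or
  locally affine in the distance. The case distinction in the bound records that the derivative
  lives on the transition zone only, which is how the thin shell enters the perimeter
  estimate.\<close>

lemma has_derivative_radial_cutoff:
  assumes x: "x \<noteq> z" and 0: "\<alpha> + \<beta> * norm (x - z) \<noteq> 0" and 1: "\<alpha> + \<beta> * norm (x - z) \<noteq> 1"
  obtains D where "(radial_cutoff \<alpha> \<beta> z has_derivative D) (at x)"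
    "\<And>h. \<bar>D h\<bar> \<le> (if 0 < \<alpha> + \<beta> * norm (x - z) \<and> \<alpha> + \<beta> * norm (x - z) < 1 then \<bar>\<beta>\<bar> * norm h else 0)"
proof -
  define u where "u y = \<alpha> + \<beta> * norm (y - z)" for y
  have u: "continuous_on UNIV u" unfolding u_def by (intro continuous_intros)
  consider "u x < 0" | "0 < u x" "u x < 1" | "1 < u x" using 0 1 by (fastforce simp: u_def)
  then show ?thesis
  proof cases
    case 1
    have "open {y. u y < 0}" using u by (intro open_Collect_less) auto
    then have "(radial_cutoff \<alpha> \<beta> z has_derivative (\<lambda>_. 0)) (at x)"
      using 1 by (intro has_derivative_transform_within_open[OF has_derivative_const[of 0]])
        (auto simp: radial_cutoff_def u_def)
    then show ?thesis by (rule that) simp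
  next
    case 2
    let ?D = "\<lambda>h. \<beta> * inner h (sgn (x - z))"
    have "((\<lambda>y. norm (y - z)) has_derivative (\<lambda>h. inner h (sgn (x - z)))) (at x)"
      by (rule has_derivative_compose[of "\<lambda>y. y - z", OF _ has_derivative_norm])
         (use x in \<open>auto intro!: derivative_eq_intros\<close>)
    then have "(u has_derivative ?D) (at x)"
      unfolding u_def by (auto intro!: derivative_eq_intros)
    moreover have "open {y. 0 < u y \<and> u y < 1}"
      using u by (intro open_Collect_conj open_Collect_less) auto
    ultimately have "(radial_cutoff \<alpha> \<beta> z has_derivative ?D) (at x)"
      by (rule has_derivative_transform_within_open) (use 2 in \<open>auto simp: radial_cutoff_def u_def\<close>)
    moreover have "\<bar>?D h\<bar> \<le> \<bar>\<beta>\<bar> * norm h" for h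
      using Cauchy_Schwarz_ineq2[of h "sgn (x - z)"] x
      by (auto simp: abs_mult norm_sgn intro!: mult_left_mono)
    ultimately show ?thesis using 2 by (intro that) (auto simp: u_def)
  next
    case 3
    have "open {y. 1 < u y}" using u by (intro open_Collect_less) auto
    then have "(radial_cutoff \<alpha> \<beta> z has_derivative (\<lambda>_. 0)) (at x)"
      using 3 by (intro has_derivative_transform_within_open[OF has_derivative_const[of 1]])
        (auto simp: radial_cutoff_def u_def)
    then show ?thesis by (rule that) simp
  qed
qed

lemma lipschitz_on_mult_bounded:
  fixes f g :: "'a::metric_space \<Rightarrow> real"
  assumes f: "C-lipschitz_on U f" and g: "D-lipschitz_on U g"
    and A: "\<And>x. x \<in> U \<Longrightarrow> \<bar>f x\<bar> \<le> A" and B: "\<And>x. x \<in> U \<Longrightarrow> \<bar>g x\<bar> \<le> B"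
    and nonneg: "0 \<le> A" "0 \<le> B"
  shows "(C * B + A * D)-lipschitz_on U (\<lambda>x. f x * g x)"
proof (rule lipschitz_onI)
  note C = lipschitz_on_nonneg[OF f] and D = lipschitz_on_nonneg[OF g]
  show "0 \<le> C * B + A * D" using C D nonneg by simp
  fix x y assume xy: "x \<in> U" "y \<in> U"
  have "f x * g x - f y * g y = (f x - f y) * g x + f y * (g x - g y)" by (simp add: algebra_simps)
  then have "dist (f x * g x) (f y * g y) \<le> \<bar>f x - f y\<bar> * \<bar>g x\<bar> + \<bar>f y\<bar> * \<bar>g x - g y\<bar>"
    using abs_triangle_ineq[of "(f x - f y) * g x" "f y * (g x - g y)"] by (simp add: dist_real_def abs_mult)
  also have "\<dots> \<le> (C * dist x y) * B + A * (D * dist x y)"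
    using lipschitz_onD[OF f xy] lipschitz_onD[OF g xy] A B xy C D nonneg
    by (intro add_mono mult_mono) (auto simp: dist_real_def)
  finally show "dist (f x * g x) (f y * g y) \<le> (C * B + A * D) * dist x y"
    by (simp add: algebra_simps)
qed

text \<open>Clamping the norm to \<open>[\<delta>, S]\<close> keeps the base of \<open>powr\<close>
  in a compact interval of positive numbers, where the function and its derivative are bounded; the
  mean value theorem does the rest.\<close>

lemma powr_annulus_lipschitz_bounded:
  fixes k \<delta> S :: real
  assumes \<delta>: "0 < \<delta>" "\<delta> \<le> S"
  obtains C B where "C-lipschitz_on UNIV (\<lambda>x::'a::real_normed_vector. (max \<delta> (min S (norm x))) powr k)"
    "B \<ge> 0" "\<And>x::'a. \<bar>(max \<delta> (min S (norm x))) powr k\<bar> \<le> B"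
proof -
  define c where "c x = max \<delta> (min S (norm x))" for x :: 'a
  have c: "1-lipschitz_on UNIV c"
  proof (rule lipschitz_onI)
    fix x y :: 'a
    show "dist (c x) (c y) \<le> 1 * dist x y"
      using norm_triangle_ineq3[of x y] by (auto simp: c_def dist_real_def dist_norm)
  qed simp
  define g where "g r = r powr k" for r :: real
  have "continuous_on {\<delta>..S} (\<lambda>r. k * r powr (k - 1))" "continuous_on {\<delta>..S} g"
    unfolding g_def using \<delta> by (auto intro!: continuous_intros)
  then have "bounded ((\<lambda>r. k * r powr (k - 1)) ` {\<delta>..S})" "bounded (g ` {\<delta>..S})"
    by (auto intro!: compact_imp_bounded compact_continuous_image)
  then obtain L B where "\<forall>y\<in>(\<lambda>r. k * r powr (k - 1)) ` {\<delta>..S}. norm y \<le> L" "\<forall>y\<in>g ` {\<delta>..S}. norm y \<le> B"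
    unfolding bounded_iff by (elim exE) (rule that)
  then have L: "\<bar>k * r powr (k - 1)\<bar> \<le> L" and B: "\<bar>g r\<bar> \<le> B" if "r \<in> {\<delta>..S}" for r
    using that by auto
  have g: "L-lipschitz_on {\<delta>..S} g"
  proof (rule lipschitz_onI)
    fix x y assume xy: "x \<in> {\<delta>..S}" "y \<in> {\<delta>..S}"
    have "norm (g x - g y) \<le> L * norm (x - y)"
    proof (rule field_differentiable_bound)
      show "(g has_field_derivative k * r powr (k - 1)) (at r within {\<delta>..S})" if "r \<in> {\<delta>..S}" for r
        unfolding g_def using that \<delta> by (auto intro!: derivative_eq_intros)
    qed (use xy L in auto)
    then show "dist (g x) (g y) \<le> L * dist x y" by (simp add: dist_norm)
  next
    show "0 \<le> L" using order_trans[OF abs_ge_zero L[of \<delta>]] \<delta> by simp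
  qed
  have im: "c ` UNIV \<subseteq> {\<delta>..S}" using \<delta> by (auto simp: c_def)
  have "(L * 1)-lipschitz_on UNIV (\<lambda>x. g (c x))"
    by (rule lipschitz_on_compose2[OF c lipschitz_on_subset[OF g im]])
  moreover have "\<bar>g (c x)\<bar> \<le> B" for x using im by (intro B) blast
  moreover have "0 \<le> \<bar>g (c 0)\<bar>" by simp
  ultimately show ?thesis using order_trans that unfolding g_def c_def by metis
qed

text \<open>The derivative vanishes off the support by uniqueness of derivatives and is bounded on
  it by compactness, so the mean value inequality applies on the whole space.\<close>

lemma C1_compact_support_lipschitz_bounded:
  fixes v :: "real ^ 'n::finite \<Rightarrow> real ^ 'n"
  assumes "C1_compact_support v"
  obtains L B where "L-lipschitz_on UNIV v" "\<And>x. norm (v x) \<le> B"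
proof -
  define K where "K = closure {x. v x \<noteq> 0}"
  obtain v' :: "real ^ 'n \<Rightarrow> (real ^ 'n) \<Rightarrow>\<^sub>L (real ^ 'n)"
    where v': "\<And>x. (v has_derivative blinfun_apply (v' x)) (at x)" "continuous_on UNIV v'"
    using assms unfolding C1_compact_support_def by (elim conjE exE) (rule that, erule spec, assumption)
  have K: "compact K" using assms unfolding C1_compact_support_def K_def by (rule conjunct2)
  have "continuous_on UNIV v"
    by (intro continuous_at_imp_continuous_on ballI has_derivative_continuous[OF v'(1)])
  then have "continuous_on K v" by (rule continuous_on_subset) simp
  then have "bounded (v ` K)" by (intro compact_imp_bounded compact_continuous_image K)
  moreover have "continuous_on K v'" using v'(2) by (rule continuous_on_subset) simp
  then have "bounded (v' ` K)" by (intro compact_imp_bounded compact_continuous_image K)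
  ultimately obtain B L where "\<forall>y\<in>v ` K. norm y \<le> B" "\<forall>y\<in>v' ` K. norm y \<le> L"
    unfolding bounded_iff by (elim exE) (rule that)
  then have B: "norm (v x) \<le> B" and L: "norm (v' x) \<le> L" if "x \<in> K" for x
    using that by auto
  have out: "v x = 0" if "x \<notin> K" for x
    using that closure_subset[of "{x. v x \<noteq> 0}"] by (auto simp: K_def)
  have v'_out: "v' x = 0" if "x \<notin> K" for x
  proof -
    have "(v has_derivative (\<lambda>_. 0)) (at x)"
    proof (rule has_derivative_transform_within_open[OF has_derivative_const[of 0]])
      show "open (- K)" using compact_imp_closed[OF K] by (rule open_Compl)
      show "x \<in> - K" using that by simp
      show "0 = v y" if "y \<in> - K" for y using out[of y] that by simp
    qed
    then have "blinfun_apply (v' x) = (\<lambda>_. 0)" by (rule has_derivative_unique[OF v'(1)])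
    then show "v' x = 0" by (intro blinfun_eqI) simp
  qed
  have "norm (v' x) \<le> max 0 L" for x
  proof (cases "x \<in> K")
    case True
    then show ?thesis using L[of x] by linarith
  next
    case False
    then show ?thesis by (simp add: v'_out)
  qed
  then have on: "onorm (blinfun_apply (v' x)) \<le> max 0 L" for x by (simp only: norm_blinfun.rep_eq)
  have "norm (v x - v y) \<le> max 0 L * norm (x - y)" for x y
    by (rule differentiable_bound[where S = UNIV and f' = "\<lambda>x. blinfun_apply (v' x)"])
       (rule convex_UNIV v'(1) on UNIV_I)+
  then have "(max 0 L)-lipschitz_on UNIV v" by (intro lipschitz_onI) (simp_all add: dist_norm)
  moreover have "norm (v x) \<le> max 0 B" for x
  proof (cases "x \<in> K")
    case True
    then show ?thesis using B[of x] by linarith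
  next
    case False
    then show ?thesis by (simp add: out)
  qed
  ultimately show ?thesis by (rule that)
qed

lemma radial_cutoff_pos: "radial_cutoff \<alpha> \<beta> z x \<noteq> 0 \<Longrightarrow> 0 < \<alpha> + \<beta> * norm (x - z)"
  by (simp add: radial_cutoff_def max_def min_def split: if_splits)

lemma radial_cutoff_ball:
  assumes "n > 0" "radial_cutoff n (- n) z x \<noteq> 0"
  shows "x \<in> ball z 1"
proof -
  have "n * norm (x - z) < n * 1"
    using radial_cutoff_pos[OF assms(2)] by simp
  then show ?thesis using assms(1) by (simp add: dist_norm norm_minus_commute)
qed

text \<open>The cutoff removes a neighbourhood of the origin, where \<open>|x|\<^sup>k v\<close> is not differentiable, at the cost
  of a term that vanishes as \<open>n \<rightarrow> \<infinity>\<close> because \<open>k + N - 1 > 0\<close>.\<close>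

lemma shell_cutoff_divergence_le:
  fixes v :: "real ^ 'n::finite \<Rightarrow> real ^ 'n" and k n :: real
  assumes v: "C1_compact_support v" "\<And>x. x \<in> ball z 1 \<Longrightarrow> norm (v x) \<le> 1"
    and n: "n \<ge> 1"
  defines "\<eta> \<equiv> \<lambda>x. radial_cutoff n (- n) z x * radial_cutoff (- 1) n 0 x"
  obtains D where "integrable lborel D" "(LINT x|lborel. D x) = 0"
    "AE x in lborel. \<eta> x * divergence (\<lambda>y. norm y powr k *\<^sub>R v y) x \<le>
       D x + n * (indicator (ball z 1 - ball z (1 - 1 / n)) x * norm x powr k)
           + n * (indicator (ball 0 (2 / n)) x * norm x powr k)"
proof -
  define F where "F y = norm y powr k *\<^sub>R v y" for y
  define S where "S = norm z + 1"
  define \<phi> where "\<phi> = radial_cutoff n (- n) z"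
  define \<psi> where "\<psi> = radial_cutoff (- 1) n (0 :: real ^ 'n)"
  \<comment> \<open>equals \<open>|x|\<^sup>k\<close> wherever the cutoff is nonzero, but is globally Lipschitz\<close>
  define W where "W x = (max (1 / n) (min (S + 1) (norm x))) powr k" for x :: "real ^ 'n"
  define G where "G i x = \<eta> x * W x * v x $ i" for i x
  have \<eta>: "\<eta> x = \<phi> x * \<psi> x" for x by (simp add: \<eta>_def \<phi>_def \<psi>_def)
  have bnd: "0 \<le> \<phi> x" "\<phi> x \<le> 1" "0 \<le> \<psi> x" "\<psi> x \<le> 1" for x
    by (auto simp: \<phi>_def \<psi>_def radial_cutoff_bounds)
  have \<eta>_bnd: "0 \<le> \<eta> x" "\<eta> x \<le> 1" for x
    using bnd[of x] by (auto simp: \<eta> intro: mult_le_one)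
  have in_ball: "x \<in> ball z 1" if "\<phi> x \<noteq> 0" for x
    using radial_cutoff_ball[of n z x] that n by (simp add: \<phi>_def)
  have G: "G i x = \<eta> x * F x $ i" for i x
  proof (cases "\<eta> x = 0")
    case False
    then have nz: "\<phi> x \<noteq> 0" "\<psi> x \<noteq> 0" by (auto simp: \<eta>)
    have "0 < - 1 + n * norm (x - 0)"
      using nz(2) unfolding \<psi>_def by (rule radial_cutoff_pos)
    then have "1 / n < norm x" using n by (simp add: field_simps)
    moreover have "norm x < S"
      using in_ball[OF nz(1)] norm_triangle_ineq[of z "x - z"] unfolding S_def
      by (auto simp: dist_norm norm_minus_commute)
    ultimately have "W x = norm x powr k" by (simp add: W_def)
    then show ?thesis by (simp add: G_def F_def)
  qed (simp add: G_def)
  have supp: "G i x = 0" if "S \<le> norm x" for i x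
  proof -
    have "\<phi> x = 0"
      using that in_ball[of x] norm_triangle_ineq[of z "x - z"] unfolding S_def
      by (auto simp: dist_norm norm_minus_commute)
    then show ?thesis by (simp add: G \<eta>)
  qed
  obtain L B where L: "L-lipschitz_on UNIV v" and B: "\<And>x. norm (v x) \<le> B"
    using C1_compact_support_lipschitz_bounded[OF v(1)] by blast
  have B0: "B \<ge> 0" using B norm_ge_zero order_trans by blast
  have "1 / n \<le> 1" using n by simp
  then have n1: "0 < 1 / n" "1 / n \<le> S + 1" using n norm_ge_zero[of z] unfolding S_def by (simp, linarith)
  obtain CW BW where CW: "CW-lipschitz_on UNIV W" "BW \<ge> 0" "\<And>x. \<bar>W x\<bar> \<le> BW"
    using powr_annulus_lipschitz_bounded[OF n1, of k, where 'a = "real ^ 'n"] unfolding W_def by blast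
  have "(\<bar>- n\<bar> * 1 + 1 * \<bar>n\<bar>)-lipschitz_on UNIV \<eta>"
    unfolding \<eta>_def
    by (intro lipschitz_on_mult_bounded lipschitz_radial_cutoff) (auto simp: radial_cutoff_bounds)
  then have "((\<bar>- n\<bar> * 1 + 1 * \<bar>n\<bar>) * BW + 1 * CW)-lipschitz_on UNIV (\<lambda>x. \<eta> x * W x)"
    using CW \<eta>_bnd by (intro lipschitz_on_mult_bounded) auto
  moreover have "L-lipschitz_on UNIV (\<lambda>x. v x $ i)" for i
  proof (rule lipschitz_onI)
    show "dist (v x $ i) (v y $ i) \<le> L * dist x y" for x y
      using lipschitz_onD[OF L, of x y] dist_vec_nth_le[of "v x" i "v y"] by simp
  qed (rule lipschitz_on_nonneg[OF L])
  ultimately have lip: "(((\<bar>- n\<bar> * 1 + 1 * \<bar>n\<bar>) * BW + 1 * CW) * B + BW * L)-lipschitz_on UNIV (G i)" for i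
    unfolding G_def
  proof (rule lipschitz_on_mult_bounded)
    show "\<bar>\<eta> x * W x\<bar> \<le> BW" for x
      using mult_mono[OF \<eta>_bnd(2)[of x] CW(3)[of x]] \<eta>_bnd[of x] by (auto simp: abs_mult)
    show "\<bar>v x $ i\<bar> \<le> B" for x
      using component_le_norm_cart[of "v x" i] B[of x] by linarith
  qed (use CW B0 in auto)
  \<comment> \<open>All points where a cutoff or the weight can fail to be differentiable: the two
    centres and the four spheres on which a cutoff reaches 0 or 1.\<close>
  define bad where "bad = {z, 0} \<union> sphere z 1 \<union> sphere z (1 - 1 / n) \<union> sphere 0 (1 / n) \<union> sphere 0 (2 / n)"
  have "negligible bad"
    unfolding bad_def by (intro negligible_Un negligible_sphere) (auto intro: negligible_finite)
  then have "AE x in lebesgue. x \<notin> bad"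
    by (intro AE_not_in) (simp add: negligible_iff_null_sets)
  then have good: "AE x in lborel. x \<notin> bad"
    by (simp add: AE_completion_iff)
  have deriv: "\<exists>D\<phi> D\<psi> DF. (\<phi> has_derivative D\<phi>) (at x) \<and> (\<psi> has_derivative D\<psi>) (at x) \<and> (F has_derivative DF) (at x)
      \<and> (\<forall>h. \<bar>D\<phi> h\<bar> \<le> n * (indicator (ball z 1 - ball z (1 - 1 / n)) x * norm h))
      \<and> (\<forall>h. \<bar>D\<psi> h\<bar> \<le> n * (indicator (ball 0 (2 / n)) x * norm h))"
    if x: "x \<notin> bad" for x
  proof -
    have xb: "x \<noteq> z" "x \<noteq> 0" "norm (x - z) \<noteq> 1" "norm (x - z) \<noteq> 1 - 1 / n" "norm x \<noteq> 1 / n" "norm x \<noteq> 2 / n"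
      using x by (auto simp: bad_def dist_norm norm_minus_commute)
    have 1: "n + - n * norm (x - z) \<noteq> 0" "n + - n * norm (x - z) \<noteq> 1"
      using xb n by (auto simp: field_simps)
    obtain D\<phi> where D\<phi>: "(\<phi> has_derivative D\<phi>) (at x)"
      "\<And>h. \<bar>D\<phi> h\<bar> \<le> (if 0 < n + - n * norm (x - z) \<and> n + - n * norm (x - z) < 1 then \<bar>- n\<bar> * norm h else 0)"
      unfolding \<phi>_def using has_derivative_radial_cutoff[OF xb(1) 1] by blast
    have 2: "- 1 + n * norm (x - 0) \<noteq> 0" "- 1 + n * norm (x - 0) \<noteq> 1"
      using xb n by (auto simp: field_simps)
    obtain D\<psi> where D\<psi>: "(\<psi> has_derivative D\<psi>) (at x)"
      "\<And>h. \<bar>D\<psi> h\<bar> \<le> (if 0 < - 1 + n * norm (x - 0) \<and> - 1 + n * norm (x - 0) < 1 then \<bar>n\<bar> * norm h else 0)"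
      unfolding \<psi>_def using has_derivative_radial_cutoff[OF xb(2) 2] by blast
    obtain v' where "(v has_derivative v') (at x)"
      using v(1) unfolding C1_compact_support_def by blast
    moreover have "((\<lambda>y. norm y powr k) has_derivative (\<lambda>h. norm x powr k * (0 * ln (norm x) + inner h (sgn x) * k / norm x))) (at x)"
      using xb(2) by (intro has_derivative_powr has_derivative_norm has_derivative_const) auto
    ultimately have "\<exists>DF. (F has_derivative DF) (at x)"
      unfolding F_def using has_derivative_scaleR by blast
    moreover have "\<bar>D\<phi> h\<bar> \<le> n * (indicator (ball z 1 - ball z (1 - 1 / n)) x * norm h)" for h
    proof (cases "0 < n + - n * norm (x - z) \<and> n + - n * norm (x - z) < 1")
      case True
      then have "x \<in> ball z 1 - ball z (1 - 1 / n)"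
        using n by (auto simp: dist_norm norm_minus_commute field_simps)
      then show ?thesis using D\<phi>(2)[of h] True n by simp
    qed (use D\<phi>(2)[of h] n in \<open>auto split: split_indicator\<close>)
    moreover have "\<bar>D\<psi> h\<bar> \<le> n * (indicator (ball 0 (2 / n)) x * norm h)" for h
    proof (cases "0 < - 1 + n * norm (x - 0) \<and> - 1 + n * norm (x - 0) < 1")
      case True
      then have "x \<in> ball 0 (2 / n)"
        using n by (auto simp: field_simps)
      then show ?thesis using D\<psi>(2)[of h] True n by simp
    qed (use D\<psi>(2)[of h] n in \<open>auto split: split_indicator\<close>)
    ultimately show ?thesis using D\<phi>(1) D\<psi>(1) by blast
  qed
  have G_deriv: "(G i has_derivative (\<lambda>h. \<eta> x * DF h $ i + (\<phi> x * D\<psi> h + D\<phi> h * \<psi> x) * F x $ i)) (at x)"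
    if "(\<phi> has_derivative D\<phi>) (at x)" "(\<psi> has_derivative D\<psi>) (at x)" "(F has_derivative DF) (at x)" for x D\<phi> D\<psi> DF i
    unfolding G \<eta> using that
    by (intro has_derivative_mult bounded_linear.has_derivative[OF bounded_linear_vec_nth])
  have "AE x in lborel. G i differentiable (at x)" for i
    using good
  proof (rule eventually_mono)
    show "G i differentiable (at x)" if "x \<notin> bad" for x
      using deriv[OF that] G_deriv unfolding differentiable_def by blast
  qed
  \<comment> \<open>Component \<open>i\<close> is differentiated in direction \<open>i\<close> only,
    so the sum of the \<open>g i\<close> is almost everywhere the divergence of
    \<open>\<eta>\<close> times \<open>F\<close>, and it has integral 0.\<close>
  then have "\<forall>i. \<exists>g. integrable lborel g \<and> (LINT x|lborel. g x) = 0 \<and>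
      (\<forall>x D. (G i has_derivative D) (at x) \<longrightarrow> g x = D (axis i 1))"
    using integral_directional_derivative_eq_0[OF lip supp] by metis
  then obtain g where g: "\<And>i. integrable lborel (g i)" "\<And>i. (LINT x|lborel. g i x) = 0"
    "\<And>i x D. (G i has_derivative D) (at x) \<Longrightarrow> g i x = D (axis i 1)"
    by metis
  show ?thesis
  proof (rule that)
    show "integrable lborel (\<lambda>x. \<Sum>i\<in>UNIV. g i x)" "(LINT x|lborel. (\<Sum>i\<in>UNIV. g i x)) = 0"
      using g(1,2) by (auto simp: Bochner_Integration.integral_sum)
    show "AE x in lborel. \<eta> x * divergence (\<lambda>y. norm y powr k *\<^sub>R v y) x \<le>
       (\<Sum>i\<in>UNIV. g i x) + n * (indicator (ball z 1 - ball z (1 - 1 / n)) x * norm x powr k)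
           + n * (indicator (ball 0 (2 / n)) x * norm x powr k)"
      using good
    proof (rule eventually_mono)
      fix x assume "x \<notin> bad"
      then obtain D\<phi> D\<psi> DF where D: "(\<phi> has_derivative D\<phi>) (at x)" "(\<psi> has_derivative D\<psi>) (at x)" "(F has_derivative DF) (at x)"
        and D\<phi>: "\<And>h. \<bar>D\<phi> h\<bar> \<le> n * (indicator (ball z 1 - ball z (1 - 1 / n)) x * norm h)"
        and D\<psi>: "\<And>h. \<bar>D\<psi> h\<bar> \<le> n * (indicator (ball 0 (2 / n)) x * norm h)"
        using deriv by blast
      have lin: "(\<Sum>i\<in>UNIV. D' (axis i 1) * y $ i) = D' y" if "(f has_derivative D') (at x)"
        for f :: "real ^ 'n \<Rightarrow> real" and D' and y :: "real ^ 'n"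
      proof -
        have l: "linear D'" using that by (rule has_derivative_linear)
        have "(\<Sum>i\<in>UNIV. y $ i *\<^sub>R axis i 1) = y"
          using basis_expansion[of y] by (simp add: scalar_mult_eq_scaleR)
        then have "D' y = D' (\<Sum>i\<in>UNIV. y $ i *\<^sub>R axis i 1)"
          by simp
        also have "\<dots> = (\<Sum>i\<in>UNIV. D' (axis i 1) * y $ i)"
          by (simp add: linear_sum[OF l] linear_cmul[OF l] mult.commute)
        finally show ?thesis ..
      qed
      \<comment> \<open>The constraint on \<open>v\<close> holds only inside the unit ball around
        \<open>z\<close>; outside it \<open>\<phi>\<close> vanishes.\<close>
      have Fx: "\<phi> x = 0 \<or> norm (F x) \<le> norm x powr k"
        using in_ball[of x] v(2)[of x] unfolding F_def by (auto intro: mult_left_le)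
      \<comment> \<open>Product rule for the divergence. The term with \<open>D\<phi>\<close> is
        supported on the outer shell, the term with \<open>D\<psi>\<close> near the origin.\<close>
      have "(\<Sum>i\<in>UNIV. g i x) = \<eta> x * divergence F x + (\<phi> x * D\<psi> (F x) + D\<phi> (F x) * \<psi> x)"
      proof -
        have "(\<Sum>i\<in>UNIV. g i x) = (\<Sum>i\<in>UNIV. \<eta> x * DF (axis i 1) $ i + (\<phi> x * (D\<psi> (axis i 1) * F x $ i) + D\<phi> (axis i 1) * F x $ i * \<psi> x))"
          by (intro sum.cong refl) (simp add: g(3)[OF G_deriv[OF D]] algebra_simps)
        also have "\<dots> = \<eta> x * (\<Sum>i\<in>UNIV. DF (axis i 1) $ i) + (\<phi> x * D\<psi> (F x) + D\<phi> (F x) * \<psi> x)"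
          by (simp add: sum.distrib sum_distrib_left[symmetric] sum_distrib_right[symmetric] lin[OF D(1)] lin[OF D(2)])
        finally show ?thesis by (simp add: divergence_def frechet_derivative_at[OF D(3), symmetric])
      qed
      moreover have "\<bar>\<phi> x * D\<psi> (F x)\<bar> \<le> n * (indicator (ball 0 (2 / n)) x * norm x powr k)"
      proof -
        have "\<bar>\<phi> x * D\<psi> (F x)\<bar> \<le> \<phi> x * (n * (indicator (ball 0 (2 / n)) x * norm (F x)))"
          using bnd[of x] D\<psi>[of "F x"] by (auto simp: abs_mult intro: mult_left_mono)
        also have "\<dots> \<le> \<phi> x * (n * (indicator (ball 0 (2 / n)) x * norm x powr k))"
          using Fx
        proof
          assume "norm (F x) \<le> norm x powr k"
          then show ?thesis using bnd[of x] n by (intro mult_left_mono) auto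
        qed simp
        also have "\<dots> \<le> 1 * (n * (indicator (ball 0 (2 / n)) x * norm x powr k))"
          using bnd[of x] n by (intro mult_right_mono) auto
        finally show ?thesis by simp
      qed
      moreover have "\<bar>D\<phi> (F x) * \<psi> x\<bar> \<le> n * (indicator (ball z 1 - ball z (1 - 1 / n)) x * norm x powr k)"
      proof -
        have "\<bar>D\<phi> (F x)\<bar> \<le> n * (indicator (ball z 1 - ball z (1 - 1 / n)) x * norm x powr k)"
        proof (cases "x \<in> ball z 1")
          case True
          then have "norm (F x) \<le> norm x powr k"
            using v(2)[of x] unfolding F_def by (auto intro: mult_left_le)
          then show ?thesis using n by (intro order_trans[OF D\<phi>] mult_left_mono) auto
        qed (use D\<phi>[of "F x"] in simp)
        then have "\<bar>D\<phi> (F x)\<bar> * \<psi> x \<le> n * (indicator (ball z 1 - ball z (1 - 1 / n)) x * norm x powr k) * 1"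
          using bnd[of x] n by (intro mult_mono) auto
        then show ?thesis using bnd[of x] by (simp add: abs_mult)
      qed
      ultimately show "\<eta> x * divergence (\<lambda>y. norm y powr k *\<^sub>R v y) x \<le>
       (\<Sum>i\<in>UNIV. g i x) + n * (indicator (ball z 1 - ball z (1 - 1 / n)) x * norm x powr k)
           + n * (indicator (ball 0 (2 / n)) x * norm x powr k)"
        unfolding F_def[symmetric] by linarith
    qed
  qed
qed

section \<open>The perimeter bound in the limit of thin shells\<close>

lemma eventually_ge_real_mult:
  fixes c C :: real
  assumes "c > 0"
  shows "\<forall>\<^sub>F n in sequentially. C \<le> real n * c"
proof -
  have "filterlim (\<lambda>n. c * real n) at_top sequentially"
    by (rule filterlim_tendsto_pos_mult_at_top[OF tendsto_const assms filterlim_real_sequentially])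
  then show ?thesis by (simp add: filterlim_at_top mult.commute)
qed

lemma set_integrable_norm_powr:
  fixes A :: "'a::euclidean_space set"
  assumes "l + real DIM('a) > 0" "A \<in> sets borel" "bounded A"
  shows "set_integrable lborel A (\<lambda>x. norm x powr l)"
proof -
  obtain R where R: "R > 0" "A \<subseteq> ball 0 R"
    using assms(3) bounded_subset_ballD[of A 0] by auto
  show ?thesis
    by (rule set_integrable_subset[OF integrable_norm_powr_ball[of R l]]) (use assms R in auto)
qed

text \<open>Some admissible \<open>v\<close> has a divergence integral above \<open>q\<close>. The
  cutoffs change this integral by an amount tending to 0, and the cut-off integral is at most the
  shell term plus a vanishing term at the origin. Working with reals \<open>q\<close> below the
  perimeter requires neither its finiteness nor the convergence of the shell integrals.\<close>

lemma less_weighted_perimeter_ball: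
  fixes z :: "real ^ 'n::finite" and k q :: real
  assumes k: "k + real CARD('n) - 1 > 0"
    and q: "ereal q < weighted_perimeter k (ball z 1)"
  shows "\<forall>\<^sub>F n in sequentially.
    q < real n * (LINT x:(ball z 1 - ball z (1 - 1 / real n))|lborel. norm x powr k)"
proof -
  define E where "E n = real n * (LINT x:(ball z 1 - ball z (1 - 1 / real n))|lborel. norm x powr k)" for n
  define e where "e n = real n * (LINT x:ball (0 :: real ^ 'n) (2 / real n)|lborel. norm x powr k)" for n
  obtain v :: "real ^ 'n \<Rightarrow> real ^ 'n" where v: "C1_compact_support v" "\<And>x. x \<in> ball z 1 \<Longrightarrow> norm (v x) \<le> 1"
    and I: "q < (LINT x:ball z 1|lebesgue. divergence (\<lambda>y. norm y powr k *\<^sub>R v y) x)"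
    using q unfolding weighted_perimeter_def less_SUP_iff by auto
  define f where "f x = indicator (ball z 1) x * divergence (\<lambda>y. norm y powr k *\<^sub>R v y) x" for x
  have I': "q < (LINT x|lebesgue. f x)"
    using I by (simp add: set_lebesgue_integral_def f_def)
  have E0: "0 \<le> E n" for n
    unfolding E_def set_lebesgue_integral_def by (intro mult_nonneg_nonneg Bochner_Integration.integral_nonneg) auto
  show ?thesis
  proof (cases "integrable lebesgue f")
    case False
    \<comment> \<open>the Bochner integral of a non-integrable function is \<open>0\<close>\<close>
    then have "q < 0" using I' by (simp add: not_integrable_integral_eq)
    then show ?thesis
      using E0 unfolding E_def by (intro always_eventually allI) (rule less_le_trans)
  next
    case True
    define \<eta> where "\<eta> n x = radial_cutoff (real n) (- real n) z x * radial_cutoff (- 1) (real n) 0 x" for n :: nat and x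
    have \<eta>_bnd: "0 \<le> \<eta> n x" "\<eta> n x \<le> 1" for n x
      unfolding \<eta>_def by (intro mult_nonneg_nonneg mult_le_one radial_cutoff_bounds)+
    have \<eta>_meas [measurable]: "\<eta> n \<in> borel_measurable lebesgue" for n
    proof -
      have "continuous_on UNIV (\<eta> n)"
        unfolding \<eta>_def by (intro continuous_intros lipschitz_on_continuous_on[OF lipschitz_radial_cutoff])
      then show ?thesis by (intro measurable_completion) (simp add: borel_measurable_continuous_onI)
    qed
    have \<eta>_lim: "(\<lambda>n. \<eta> n x * f x) \<longlonglongrightarrow> f x" if "x \<noteq> 0" for x
    proof (cases "x \<in> ball z 1")
      case True
      then have "\<forall>\<^sub>F n in sequentially. 1 \<le> real n * (1 - norm (x - z))"
        by (intro eventually_ge_real_mult) (simp add: dist_norm norm_minus_commute)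
      moreover have "\<forall>\<^sub>F n in sequentially. 2 \<le> real n * norm x"
        using that by (intro eventually_ge_real_mult) simp
      ultimately have "\<forall>\<^sub>F n in sequentially. \<eta> n x * f x = f x"
      proof eventually_elim
        case (elim n)
        then have "radial_cutoff (real n) (- real n) z x = 1" "radial_cutoff (- 1) (real n) 0 x = 1"
          by (auto simp: radial_cutoff_def algebra_simps)
        then show ?case by (simp add: \<eta>_def)
      qed
      then show ?thesis by (rule tendsto_eventually)
    qed (simp add: f_def)
    have AE0: "AE x in lebesgue. x \<noteq> (0 :: real ^ 'n)"
      by (rule AE_completion[OF AE_lborel_singleton])
    have lim: "(\<lambda>n. LINT x|lebesgue. \<eta> n x * f x) \<longlonglongrightarrow> (LINT x|lebesgue. f x)"
    proof (rule integral_dominated_convergence[where w = "\<lambda>x. norm (f x)"])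
      show "AE x in lebesgue. (\<lambda>n. \<eta> n x * f x) \<longlonglongrightarrow> f x"
        using AE0 by (rule eventually_mono) (rule \<eta>_lim)
      show "AE x in lebesgue. norm (\<eta> n x * f x) \<le> norm (f x)" for n
        using \<eta>_bnd by (intro AE_I2) (simp add: abs_mult mult_left_le_one_le)
    qed (use True in \<open>auto intro!: borel_measurable_times\<close>)
    \<comment> \<open>By scaling, the integral over the ball of radius \<open>2 / n\<close> is a
      constant times \<open>n powr - (k + N)\<close>. The slope of the cutoff contributes one factor
      \<open>n\<close>, which leaves the exponent \<open>- (k + N - 1)\<close>, negative by
      hypothesis.\<close>
    have e: "e \<longlonglongrightarrow> 0"
    proof -
      let ?a = "k + real CARD('n)"
      define c where "c = real CARD('n) * unit_ball_vol (real CARD('n)) * 2 powr ?a / ?a"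
      have "\<forall>\<^sub>F n in sequentially. c * real n powr (- (?a - 1)) = e n"
        using eventually_gt_at_top[of 0]
      proof eventually_elim
        case (elim n)
        have "real n powr (- (?a - 1)) = real n / real n powr ?a"
          using elim by (simp add: powr_diff)
        then show ?case
          using k elim unfolding e_def c_def
          by (subst integral_norm_powr_ball) (auto simp: powr_divide mult_ac)
      qed
      moreover have "(\<lambda>n. c * real n powr (- (?a - 1))) \<longlonglongrightarrow> c * 0"
        using k by (intro tendsto_mult_left tendsto_neg_powr filterlim_real_sequentially) auto
      ultimately show ?thesis using Lim_transform_eventually by fastforce
    qed
    have le: "(LINT x|lebesgue. \<eta> n x * f x) \<le> E n + e n" if n: "n \<ge> 1" for n
    proof -
      let ?Sh = "ball z 1 - ball z (1 - 1 / real n)" and ?B = "ball (0 :: real ^ 'n) (2 / real n)"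
      obtain D where D: "integrable lborel D" "(LINT x|lborel. D x) = 0"
        "AE x in lborel. \<eta> n x * divergence (\<lambda>y. norm y powr k *\<^sub>R v y) x \<le>
         D x + real n * (indicator ?Sh x * norm x powr k) + real n * (indicator ?B x * norm x powr k)"
        unfolding \<eta>_def
      proof (rule shell_cutoff_divergence_le[OF v, where n = "real n" and k = k])
        show "1 \<le> real n" using n by simp
      qed
      have i1: "integrable lborel (\<lambda>x. indicator ?Sh x * norm x powr k)"
        using set_integrable_norm_powr[of k ?Sh] k bounded_diff[OF bounded_ball, of z 1]
        by (simp add: set_integrable_def)
      have i2: "integrable lborel (\<lambda>x. indicator ?B x * norm x powr k)"
        using set_integrable_norm_powr[of k ?B] k by (simp add: set_integrable_def)
      let ?H = "\<lambda>x. D x + real n * (indicator ?Sh x * norm x powr k) + real n * (indicator ?B x * norm x powr k)"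
      have H: "integrable lborel ?H" using D(1) i1 i2 by auto
      have eq: "\<eta> n x * f x = \<eta> n x * divergence (\<lambda>y. norm y powr k *\<^sub>R v y) x" for x
        using radial_cutoff_ball[of "real n" z x] n by (cases "x \<in> ball z 1") (auto simp: f_def \<eta>_def)
      have "(LINT x|lebesgue. \<eta> n x * f x) \<le> (LINT x|lebesgue. ?H x)"
      proof (rule integral_mono_AE)
        show "integrable lebesgue (\<lambda>x. \<eta> n x * f x)"
          using \<eta>_bnd True
          by (intro Bochner_Integration.integrable_bound[OF True] borel_measurable_times \<eta>_meas)
             (auto simp: abs_mult mult_left_le_one_le)
        show "integrable lebesgue ?H" using H integrable_completion borel_measurable_integrable by blast
        show "AE x in lebesgue. \<eta> n x * f x \<le> ?H x"
          using AE_completion[OF D(3)] by (simp add: eq)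
      qed
      also have "\<dots> = (LINT x|lborel. ?H x)"
        using H by (intro integral_completion) auto
      also have "\<dots> = E n + e n"
        using D(1,2) i1 i2 by (simp add: E_def e_def set_lebesgue_integral_def)
      finally show ?thesis .
    qed
    have "(\<lambda>n. (LINT x|lebesgue. \<eta> n x * f x) - e n) \<longlonglongrightarrow> (LINT x|lebesgue. f x) - 0"
      by (intro tendsto_diff lim e)
    then have "\<forall>\<^sub>F n in sequentially. q < (LINT x|lebesgue. \<eta> n x * f x) - e n"
      using I' by (intro order_tendstoD(1)) auto
    then show ?thesis
      using eventually_ge_at_top[of 1]
    proof eventually_elim
      case (elim n)
      then show ?case using le[of n] unfolding E_def by linarith
    qed
  qed
qed

section \<open>Second-order expansions for translated balls\<close>

text \<open>Lagrange's form of the remainder. For \<open>\<bar>s\<bar> \<le> 3/4\<close> the base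
  \<open>1 + s\<close> stays at least \<open>1/4\<close>, so the derivative of order
  \<open>n\<close> is bounded for every real exponent. The uses below have
  \<open>\<bar>s\<bar>\<close> at most \<open>5/8\<close>.\<close>

lemma one_plus_powr_taylor_bound:
  fixes p :: real
  assumes n: "n > 0"
  obtains C where "C \<ge> 0"
    "\<And>s. \<bar>s\<bar> \<le> 3/4 \<Longrightarrow> \<bar>(1 + s) powr p - (\<Sum>m<n. (p gchoose m) * s ^ m)\<bar> \<le> C * \<bar>s\<bar> ^ n"
proof -
  define d where "d m s = (\<Prod>i<m. p - real i) * (1 + s) powr (p - real m)" for m s
  have "continuous_on {-3/4..3/4} (d n)"
    unfolding d_def by (intro continuous_intros) auto
  then have "bounded (d n ` {-3/4..3/4})"
    by (intro compact_imp_bounded compact_continuous_image) auto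
  then obtain B where B: "\<forall>y \<in> d n ` {-3/4..3/4}. norm y \<le> B"
    unfolding bounded_iff by (elim exE) (rule that)
  then have Bs: "\<bar>d n s\<bar> \<le> B" if "\<bar>s\<bar> \<le> 3/4" for s
    using that by (force simp: abs_le_iff)
  have B0: "B \<ge> 0" using order_trans[OF abs_ge_zero Bs[of 0]] by simp
  show ?thesis
  proof (rule that)
    show "0 \<le> B / fact n" using B0 by simp
    fix s :: real assume s: "\<bar>s\<bar> \<le> 3/4"
    show "\<bar>(1 + s) powr p - (\<Sum>m<n. (p gchoose m) * s ^ m)\<bar> \<le> B / fact n * \<bar>s\<bar> ^ n"
    proof (cases "s = 0")
      case True
      have "(\<Sum>m<n. (p gchoose m) * 0 ^ m) = (\<Sum>m\<in>{0}. (p gchoose m) * 0 ^ m)"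
        using n by (intro sum.mono_neutral_right) auto
      then show ?thesis using True n B0 by simp
    next
      case False
      have d0: "d 0 = (\<lambda>s. (1 + s) powr p)" by (simp add: d_def fun_eq_iff)
      have "DERIV (d m) t :> d (Suc m) t" if "- 3/4 \<le> t" "t \<le> 3/4" for m t
        unfolding d_def using that by (auto intro!: derivative_eq_intros simp: algebra_simps)
      then have "\<exists>t. (if s < 0 then s < t \<and> t < 0 else 0 < t \<and> t < s) \<and>
        (1 + s) powr p = (\<Sum>m<n. d m 0 / fact m * (s - 0) ^ m) + d n t / fact n * (s - 0) ^ n"
        using n s False d0
        by (intro Taylor[where diff = d and a = "-3/4" and b = "3/4"]) (auto simp: abs_le_iff)
      then obtain t where t: "if s < 0 then s < t \<and> t < 0 else 0 < t \<and> t < s"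
        and eq: "(1 + s) powr p = (\<Sum>m<n. d m 0 / fact m * s ^ m) + d n t / fact n * s ^ n"
        by auto
      have "d m 0 / fact m = (p gchoose m)" for m
        by (simp add: d_def gbinomial_prod_rev lessThan_atLeast0)
      then have "\<bar>(1 + s) powr p - (\<Sum>m<n. (p gchoose m) * s ^ m)\<bar> = \<bar>d n t\<bar> / fact n * \<bar>s\<bar> ^ n"
        using eq by (simp add: abs_mult power_abs)
      also have "\<dots> \<le> B / fact n * \<bar>s\<bar> ^ n"
        using Bs[of t] t s by (intro mult_right_mono divide_right_mono) (auto split: if_splits)
      finally show ?thesis .
    qed
  qed
qed

text \<open>Unlike the norm, its square is a polynomial in the size of a translation, so all
  expansions are made in the square with half the exponent.\<close>

lemma norm_powr_half: "norm x powr k = (norm x ^ 2) powr (k / 2)"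
  by (cases "x = 0") (simp_all add: powr_powr flip: powr_numeral)

text \<open>The squared norm of \<open>t *\<^sub>R e + y\<close> is \<open>1 + s\<close> with
  \<open>s = \<tau> + 2 * t * w + t\<^sup>2\<close>, where \<open>\<tau>\<close> is of order
  \<open>\<epsilon>\<close>, the future shell thickness. Expanding
  \<open>(1 + s) powr (k / 2)\<close> to second order, the square of \<open>2 * t * w\<close> has
  the coefficient \<open>c\<close>, and \<open>4 * c\<close> equals
  \<open>k * (k - 2) / 2\<close>.\<close>

lemma norm_powr_taylor_upper:
  fixes k :: real
  obtains C where "C \<ge> 0"
    "\<And>t \<epsilon> (y :: 'a::real_inner) e. 0 \<le> t \<Longrightarrow> t \<le> 1/8 \<Longrightarrow> 0 \<le> \<epsilon> \<Longrightarrow> \<epsilon> \<le> 1/8 \<Longrightarrow>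
      1 - \<epsilon> \<le> norm y \<Longrightarrow> norm y \<le> 1 \<Longrightarrow> norm e = 1 \<Longrightarrow>
      norm (t *\<^sub>R e + y) powr k \<le>
        1 + k / 2 * t\<^sup>2 + k * t * (y \<bullet> e) + k * (k - 2) / 2 * t\<^sup>2 * (y \<bullet> e)\<^sup>2 + C * (t ^ 3 + \<epsilon>)"
proof -
  define m where "m = k / 2"
  define c where "c = m * (m - 1) / 2"
  obtain K where K: "K \<ge> 0"
    "\<And>s. \<bar>s\<bar> \<le> 3/4 \<Longrightarrow> \<bar>(1 + s) powr m - (\<Sum>i<3. (m gchoose i) * s ^ i)\<bar> \<le> K * \<bar>s\<bar> ^ 3"
    using one_plus_powr_taylor_bound[of 3 m] by auto
  have g: "(\<Sum>i<3. (m gchoose i) * s ^ i) = 1 + m * s + c * s\<^sup>2" for s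
    by (simp add: eval_nat_numeral gbinomial_prod_rev c_def field_simps)
  show ?thesis
  proof (rule that)
    \<comment> \<open>The three summands pay for dropping \<open>\<tau>\<close> from the linear
      term, for reducing \<open>s\<^sup>2\<close> to \<open>4 * t\<^sup>2 * w\<^sup>2\<close>, and
      for the cubic remainder, where 27 is the cube of the 3 in
      \<open>\<bar>s\<bar> \<le> 3 * t + 2 * \<epsilon>\<close>.\<close>
    show "0 \<le> 2 * \<bar>m\<bar> + 5 * \<bar>c\<bar> + 27 * K" using K by simp
    fix t \<epsilon> :: real and y e :: 'a
    assume t: "0 \<le> t" "t \<le> 1/8" and \<epsilon>: "0 \<le> \<epsilon>" "\<epsilon> \<le> 1/8"
      and y: "1 - \<epsilon> \<le> norm y" "norm y \<le> 1" and e: "norm e = 1"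
    define w where "w = y \<bullet> e"
    define \<tau> where "\<tau> = (norm y)\<^sup>2 - 1"
    define s where "s = \<tau> + 2 * t * w + t\<^sup>2"
    have w: "\<bar>w\<bar> \<le> 1" using Cauchy_Schwarz_ineq2[of y e] y e unfolding w_def by simp
    have tw: "\<bar>t * w\<bar> \<le> t" using w t by (simp add: abs_mult mult_left_le)
    have t2: "0 \<le> t\<^sup>2" "t\<^sup>2 \<le> t / 8" using mult_left_mono[OF t(2) t(1)] by (simp_all add: power2_eq_square)
    have "(1 - \<epsilon>)\<^sup>2 \<le> (norm y)\<^sup>2" using y \<epsilon> by (intro power_mono) auto
    moreover have "(1 - \<epsilon>)\<^sup>2 = 1 - 2 * \<epsilon> + \<epsilon>\<^sup>2" by (simp add: power2_eq_square algebra_simps)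
    moreover have "(norm y)\<^sup>2 \<le> 1" using y by (simp add: power_le_one)
    ultimately have \<tau>: "- 2 * \<epsilon> \<le> \<tau>" "\<tau> \<le> 0" using zero_le_power2[of \<epsilon>] unfolding \<tau>_def by linarith+
    have s3: "\<bar>s\<bar> \<le> 3 * t + 2 * \<epsilon>" unfolding s_def using tw t2 \<tau> t by linarith
    then have s34: "\<bar>s\<bar> \<le> 3/4" using t \<epsilon> by linarith
    have sq: "(norm (t *\<^sub>R e + y))\<^sup>2 = 1 + s"
      using e unfolding s_def \<tau>_def w_def power2_norm_eq_inner norm_eq_1
      by (simp add: inner_add_left inner_add_right inner_commute power2_eq_square)
    have "norm (t *\<^sub>R e + y) powr k = (1 + s) powr m"
      by (simp add: norm_powr_half[of _ k] sq m_def)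
    also have "\<dots> \<le> 1 + m * s + c * s\<^sup>2 + K * \<bar>s\<bar> ^ 3"
      using K(2)[OF s34] unfolding g by linarith
    also have "m * s \<le> m * (2 * t * w + t\<^sup>2) + \<bar>m\<bar> * (2 * \<epsilon>)"
    proof -
      have "m * \<tau> \<le> \<bar>m * \<tau>\<bar>" by simp
      also have "\<dots> \<le> \<bar>m\<bar> * (2 * \<epsilon>)" unfolding abs_mult using \<tau> by (intro mult_left_mono) auto
      finally show ?thesis unfolding s_def by (simp add: algebra_simps)
    qed
    also have "c * s\<^sup>2 \<le> c * (4 * t\<^sup>2 * w\<^sup>2) + \<bar>c\<bar> * (5 * t ^ 3 + 4 * \<epsilon>)"
    proof -
      \<comment> \<open>A difference of squares: \<open>s - 2 * t * w\<close> equals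
        \<open>\<tau> + t\<^sup>2\<close>, which is of order \<open>\<epsilon> + t\<^sup>2\<close>,
        while the other factor is of order \<open>t + \<epsilon>\<close>.\<close>
      have "\<bar>s\<^sup>2 - 4 * t\<^sup>2 * w\<^sup>2\<bar> = \<bar>\<tau> + t\<^sup>2\<bar> * \<bar>s + 2 * (t * w)\<bar>"
        unfolding abs_mult[symmetric] s_def by (rule arg_cong[where f = abs]) (simp add: power2_eq_square algebra_simps)
      also have "\<dots> \<le> (2 * \<epsilon> + t\<^sup>2) * (5 * t + 2 * \<epsilon>)"
      proof (rule mult_mono)
        show "\<bar>\<tau> + t\<^sup>2\<bar> \<le> 2 * \<epsilon> + t\<^sup>2" "\<bar>s + 2 * (t * w)\<bar> \<le> 5 * t + 2 * \<epsilon>" "0 \<le> 2 * \<epsilon> + t\<^sup>2"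
          using \<tau> t2 tw s3 \<epsilon> by linarith+
      qed simp
      also have "\<dots> = 5 * t ^ 3 + \<epsilon> * (10 * t + 4 * \<epsilon> + 2 * t\<^sup>2)"
        by (simp add: power2_eq_square power3_eq_cube algebra_simps)
      also have "\<dots> \<le> 5 * t ^ 3 + \<epsilon> * 4"
        using t t2 \<epsilon> by (intro add_left_mono mult_left_mono) auto
      finally have "c * (s\<^sup>2 - 4 * t\<^sup>2 * w\<^sup>2) \<le> \<bar>c\<bar> * (5 * t ^ 3 + 4 * \<epsilon>)"
        using abs_mult[of c "s\<^sup>2 - 4 * t\<^sup>2 * w\<^sup>2"] mult_left_mono[OF _ abs_ge_zero[of c]]
        by (smt (verit) mult.commute)
      then show ?thesis by (simp add: algebra_simps)
    qed
    also have "K * \<bar>s\<bar> ^ 3 \<le> K * (27 * t ^ 3 + 2 * \<epsilon>)"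
    proof (rule mult_left_mono[OF _ K(1)])
      have "\<bar>s\<bar> ^ 3 \<le> (3 * t + 2 * \<epsilon>) ^ 3" using s3 by (intro power_mono) auto
      also have "\<dots> = 27 * t ^ 3 + \<epsilon> * (54 * t\<^sup>2 + 36 * (t * \<epsilon>) + 8 * (\<epsilon> * \<epsilon>))"
        by (simp add: power2_eq_square power3_eq_cube algebra_simps)
      also have "\<dots> \<le> 27 * t ^ 3 + \<epsilon> * 2"
      proof (intro add_left_mono mult_left_mono)
        have "t * \<epsilon> \<le> (1/8) * (1/8)" "\<epsilon> * \<epsilon> \<le> (1/8) * (1/8)" using t \<epsilon> by (intro mult_mono; linarith)+
        then show "54 * t\<^sup>2 + 36 * (t * \<epsilon>) + 8 * (\<epsilon> * \<epsilon>) \<le> 2" using t2 t by linarith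
      qed (use \<epsilon> in auto)
      finally show "\<bar>s\<bar> ^ 3 \<le> 27 * t ^ 3 + 2 * \<epsilon>" by simp
    qed
    finally have "norm (t *\<^sub>R e + y) powr k \<le> 1 + (m * (2 * t * w + t\<^sup>2) + \<bar>m\<bar> * (2 * \<epsilon>)) +
        (c * (4 * t\<^sup>2 * w\<^sup>2) + \<bar>c\<bar> * (5 * t ^ 3 + 4 * \<epsilon>)) + K * (27 * t ^ 3 + 2 * \<epsilon>)"
      by simp
    also have "\<dots> = 1 + k / 2 * t\<^sup>2 + k * t * w + k * (k - 2) / 2 * t\<^sup>2 * w\<^sup>2
        + (\<bar>m\<bar> * (2 * \<epsilon>) + \<bar>c\<bar> * (5 * t ^ 3 + 4 * \<epsilon>) + K * (27 * t ^ 3 + 2 * \<epsilon>))"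
      by (simp add: m_def c_def field_simps)
    also have "\<dots> \<le> 1 + k / 2 * t\<^sup>2 + k * t * w + k * (k - 2) / 2 * t\<^sup>2 * w\<^sup>2
        + (2 * \<bar>m\<bar> * (t ^ 3 + \<epsilon>) + 5 * \<bar>c\<bar> * (t ^ 3 + \<epsilon>) + 27 * K * (t ^ 3 + \<epsilon>))"
    proof (intro add_left_mono add_mono)
      have "0 \<le> t ^ 3" using t by simp
      then show "\<bar>m\<bar> * (2 * \<epsilon>) \<le> 2 * \<bar>m\<bar> * (t ^ 3 + \<epsilon>)" "\<bar>c\<bar> * (5 * t ^ 3 + 4 * \<epsilon>) \<le> 5 * \<bar>c\<bar> * (t ^ 3 + \<epsilon>)"
        "K * (27 * t ^ 3 + 2 * \<epsilon>) \<le> 27 * K * (t ^ 3 + \<epsilon>)"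
        using \<epsilon> K(1) by (auto simp: algebra_simps mult_left_mono)
    qed
    finally show "norm (t *\<^sub>R e + y) powr k \<le>
        1 + k / 2 * t\<^sup>2 + k * t * (y \<bullet> e) + k * (k - 2) / 2 * t\<^sup>2 * (y \<bullet> e)\<^sup>2
        + (2 * \<bar>m\<bar> + 5 * \<bar>c\<bar> + 27 * K) * (t ^ 3 + \<epsilon>)"
      by (simp add: w_def algebra_simps)
  qed
qed

section \<open>Symmetries, translations and volumes, and the two expansions\<close>

lemma integral_lborel_reflect:
  fixes f :: "'a::euclidean_space \<Rightarrow> real"
  assumes [measurable]: "f \<in> borel_measurable borel"
  shows "(LINT x|lborel. f (- x)) = (LINT x|lborel. f x)"
proof -
  have "(lborel :: 'a measure) = distr lborel borel (\<lambda>x. - x)"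
    using lborel_affine[of "-1" "0::'a"] by (simp add: density_1)
  then have "(LINT x|lborel. f x) = (LINT x|distr lborel borel (\<lambda>x. - x). f x)" by simp
  also have "\<dots> = (LINT x|lborel. f (- x))" by (subst integral_distr) auto
  finally show ?thesis ..
qed

lemma set_integral_inner_symmetric:
  fixes A :: "'a::euclidean_space set"
  assumes A [measurable]: "A \<in> sets borel" and sym: "\<And>x. - x \<in> A \<longleftrightarrow> x \<in> A"
  shows "(LINT x:A|lborel. x \<bullet> c) = 0"
proof -
  let ?f = "\<lambda>x. indicat_real A x * (x \<bullet> c)"
  have [measurable]: "indicat_real A \<in> borel_measurable borel" by (rule borel_measurable_indicator[OF A])
  have m: "?f \<in> borel_measurable borel" by measurable
  have "(LINT x|lborel. ?f x) = (LINT x|lborel. ?f (- x))"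
    by (rule integral_lborel_reflect[OF m, symmetric])
  also have "\<dots> = - (LINT x|lborel. ?f x)"
    using sym by (simp add: indicator_def flip: integral_minus)
  finally show ?thesis by (simp add: set_lebesgue_integral_def)
qed

lemma set_integrable_continuous_bounded:
  fixes f :: "'a::euclidean_space \<Rightarrow> real"
  assumes "continuous_on UNIV f" "A \<in> sets borel" "bounded A"
  shows "set_integrable lborel A f"
proof -
  obtain R where R: "A \<subseteq> cball 0 R"
    using bounded_subset_ballD[OF assms(3), of 0] ball_subset_cball by blast
  have "set_integrable lborel (cball 0 R) f"
    unfolding set_integrable_def
    by (intro borel_integrable_compact continuous_on_subset[OF assms(1)]) auto
  then show ?thesis by (rule set_integrable_subset) (use assms(2) R in auto)
qed

lemma measure_lborel_ball:
  "r \<ge> 0 \<Longrightarrow> measure lborel (ball (c :: 'a::euclidean_space) r) = unit_ball_vol DIM('a) * r ^ DIM('a)"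
  by (simp add: measure_def emeasure_ball)

lemma measure_lborel_ball_diff:
  assumes "0 \<le> s" "s \<le> r"
  shows "measure lborel (ball c r - ball (c :: 'a::euclidean_space) s) =
    unit_ball_vol DIM('a) * (r ^ DIM('a) - s ^ DIM('a))"
proof -
  have "measure lborel (ball c r - ball c s) = measure lborel (ball c r) - measure lborel (ball c s)"
    using assms by (intro measure_Diff) (auto simp: emeasure_bounded_finite[unfolded infinity_ennreal_def] less_top)
  then show ?thesis using assms by (simp add: measure_lborel_ball right_diff_distrib)
qed

lemma set_integral_const_bounded:
  fixes A :: "'a::euclidean_space set"
  assumes "A \<in> sets borel" "bounded A"
  shows "(LINT x:A|lborel. c) = measure lborel A * (c::real)"
  using assms emeasure_bounded_finite[OF assms(2)]
  by (simp add: set_lebesgue_integral_def)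

lemma set_integral_translate:
  fixes A :: "'a::euclidean_space set" and f :: "'a \<Rightarrow> real"
  assumes "A \<in> sets borel" "f \<in> borel_measurable borel" and AB: "\<And>y. c + y \<in> A \<longleftrightarrow> y \<in> B"
  shows "(LINT x:A|lborel. f x) = (LINT y:B|lborel. f (c + y))"
    and "set_integrable lborel A f \<longleftrightarrow> set_integrable lborel B (\<lambda>y. f (c + y))"
proof -
  have m: "(\<lambda>x. indicat_real A x * f x) \<in> borel_measurable borel"
    by (intro borel_measurable_times borel_measurable_indicator assms)
  show "(LINT x:A|lborel. f x) = (LINT y:B|lborel. f (c + y))"
    using integral_lborel_translation(1)[OF m, of c]
    by (simp add: set_lebesgue_integral_def indicator_def AB)
  show "set_integrable lborel A f \<longleftrightarrow> set_integrable lborel B (\<lambda>y. f (c + y))"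
    using integral_lborel_translation(2)[OF m, of c]
    by (simp add: set_integrable_def indicator_def AB)
qed

text \<open>All shells are moved to one shell around the origin. Over the orthonormal basis the
  squares \<open>(y \<bullet> b)\<^sup>2\<close> add up to \<open>(norm y)\<^sup>2\<close>, which is
  1 there up to an error of order \<open>1 / n\<close>; the term linear in \<open>t\<close> is odd
  and integrates to 0.\<close>

lemma sum_shell_integral_upper:
  fixes k :: real
  assumes k: "k + real DIM('a::euclidean_space) > 0"
  obtains C where "C \<ge> 0"
    "\<And>t n :: real. 0 \<le> t \<Longrightarrow> t \<le> 1/8 \<Longrightarrow> 8 \<le> n \<Longrightarrow>
      (\<Sum>b\<in>(Basis :: 'a set). LINT x:(ball (t *\<^sub>R b) 1 - ball (t *\<^sub>R b) (1 - 1 / n))|lborel. norm x powr k) \<le>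
       unit_ball_vol DIM('a) * (1 - (1 - 1 / n) ^ DIM('a)) *
         (DIM('a) * (1 + k / 2 * t\<^sup>2) + k * (k - 2) / 2 * t\<^sup>2 + C * (t ^ 3 + 1 / n))"
proof -
  let ?N = "real DIM('a)"
  define c where "c = k * (k - 2) / 2"
  obtain K where K: "K \<ge> 0"
    "\<And>t \<epsilon> (y :: 'a) e. 0 \<le> t \<Longrightarrow> t \<le> 1/8 \<Longrightarrow> 0 \<le> \<epsilon> \<Longrightarrow> \<epsilon> \<le> 1/8 \<Longrightarrow>
      1 - \<epsilon> \<le> norm y \<Longrightarrow> norm y \<le> 1 \<Longrightarrow> norm e = 1 \<Longrightarrow>
      norm (t *\<^sub>R e + y) powr k \<le>
        1 + k / 2 * t\<^sup>2 + k * t * (y \<bullet> e) + k * (k - 2) / 2 * t\<^sup>2 * (y \<bullet> e)\<^sup>2 + K * (t ^ 3 + \<epsilon>)"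
    by (rule norm_powr_taylor_upper[of k, where 'a = 'a]) (rule that; blast)
  note K' = K(2)[folded c_def]
  show ?thesis
  proof (rule that)
    \<comment> \<open>\<open>?N * K\<close> adds up the pointwise remainders over the basis;
      \<open>2 * \<bar>c\<bar>\<close> pays for replacing \<open>(norm y)\<^sup>2\<close> by
      1.\<close>
    show "0 \<le> ?N * K + 2 * \<bar>c\<bar>" using K by simp
    fix t n :: real assume t: "0 \<le> t" "t \<le> 1/8" and n: "8 \<le> n"
    define \<epsilon> where "\<epsilon> = 1 / n"
    have \<epsilon>: "0 \<le> \<epsilon>" "\<epsilon> \<le> 1/8" using n by (auto simp: \<epsilon>_def field_simps)
    define Sh where "Sh = ball (0::'a) 1 - ball 0 (1 - \<epsilon>)"
    have Sh: "Sh \<in> sets borel" "bounded Sh" by (auto simp: Sh_def bounded_diff)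
    define a where "a = ?N * (1 + k / 2 * t\<^sup>2) + c * t\<^sup>2 + (?N * K + 2 * \<bar>c\<bar>) * (t ^ 3 + \<epsilon>)"
    have upper: "(\<Sum>b\<in>Basis. norm (t *\<^sub>R b + y) powr k) \<le> a + k * t * (y \<bullet> \<Sum>Basis)" if "y \<in> Sh" for y
    proof -
      have y: "1 - \<epsilon> \<le> norm y" "norm y \<le> 1" using that by (auto simp: Sh_def)
      have "(\<Sum>b\<in>Basis. norm (t *\<^sub>R b + y) powr k) \<le>
          (\<Sum>b\<in>Basis. 1 + k / 2 * t\<^sup>2 + k * t * (y \<bullet> b) + c * t\<^sup>2 * (y \<bullet> b)\<^sup>2 + K * (t ^ 3 + \<epsilon>))"
        using t \<epsilon> y by (intro sum_mono K') auto
      also have "\<dots> = ?N * (1 + k / 2 * t\<^sup>2) + k * t * (y \<bullet> \<Sum>Basis) + c * t\<^sup>2 * (norm y)\<^sup>2 + ?N * K * (t ^ 3 + \<epsilon>)"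
        unfolding power2_norm_eq_inner euclidean_inner[of y y]
        by (simp add: sum.distrib sum_distrib_left inner_sum_right power2_eq_square algebra_simps)
      also have "c * t\<^sup>2 * (norm y)\<^sup>2 \<le> c * t\<^sup>2 + 2 * \<bar>c\<bar> * (t ^ 3 + \<epsilon>)"
      proof -
        have "(1 - \<epsilon>)\<^sup>2 \<le> (norm y)\<^sup>2" using y \<epsilon> by (intro power_mono) auto
        moreover have "(1 - \<epsilon>)\<^sup>2 = 1 - 2 * \<epsilon> + \<epsilon>\<^sup>2" by (simp add: power2_eq_square algebra_simps)
        moreover have "(norm y)\<^sup>2 \<le> 1" using y by (simp add: power_le_one)
        ultimately have "\<bar>(norm y)\<^sup>2 - 1\<bar> \<le> 2 * \<epsilon>" using zero_le_power2[of \<epsilon>] by linarith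
        moreover have "t\<^sup>2 \<le> 1" using t by (simp add: power_le_one)
        ultimately have "\<bar>c\<bar> * (t\<^sup>2 * \<bar>(norm y)\<^sup>2 - 1\<bar>) \<le> \<bar>c\<bar> * (1 * (2 * \<epsilon>))"
          by (intro mult_left_mono mult_mono) auto
        moreover have "c * t\<^sup>2 * (norm y)\<^sup>2 - c * t\<^sup>2 \<le> \<bar>c\<bar> * (t\<^sup>2 * \<bar>(norm y)\<^sup>2 - 1\<bar>)"
        proof -
          have "c * t\<^sup>2 * (norm y)\<^sup>2 - c * t\<^sup>2 = c * (t\<^sup>2 * ((norm y)\<^sup>2 - 1))" by (simp add: algebra_simps)
          also have "\<dots> \<le> \<bar>c * (t\<^sup>2 * ((norm y)\<^sup>2 - 1))\<bar>" by (rule abs_ge_self)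
          also have "\<dots> = \<bar>c\<bar> * (t\<^sup>2 * \<bar>(norm y)\<^sup>2 - 1\<bar>)" unfolding abs_mult by simp
          finally show ?thesis .
        qed
        moreover have "0 \<le> 2 * \<bar>c\<bar> * t ^ 3" using t by simp
        ultimately show ?thesis by (simp add: algebra_simps)
      qed
      finally show ?thesis by (simp add: a_def algebra_simps)
    qed
    have nm: "(\<lambda>x::'a. norm x powr k) \<in> borel_measurable borel" by measurable
    have shift: "t *\<^sub>R b + y \<in> ball (t *\<^sub>R b) 1 - ball (t *\<^sub>R b) (1 - \<epsilon>) \<longleftrightarrow> y \<in> Sh" for b y :: 'a
      by (simp add: Sh_def dist_norm)
    have int: "set_integrable lborel Sh (\<lambda>y. norm (t *\<^sub>R b + y) powr k)" for b
      unfolding set_integral_translate(2)[OF _ nm shift, symmetric, OF sets.Diff[OF borel_open[OF open_ball] borel_open[OF open_ball]]]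
      using k by (intro set_integrable_norm_powr) (auto simp: bounded_diff)
    have inti: "set_integrable lborel Sh (\<lambda>y. a + k * t * (y \<bullet> \<Sum>Basis))"
      by (intro set_integrable_continuous_bounded continuous_intros Sh)
    have "(\<Sum>b\<in>(Basis :: 'a set). LINT x:(ball (t *\<^sub>R b) 1 - ball (t *\<^sub>R b) (1 - \<epsilon>))|lborel. norm x powr k)
        = (\<Sum>b\<in>(Basis :: 'a set). LINT y:Sh|lborel. norm (t *\<^sub>R b + y) powr k)"
      by (intro sum.cong refl set_integral_translate(1) nm shift) auto
    also have "\<dots> = (LINT y:Sh|lborel. (\<Sum>b\<in>Basis. norm (t *\<^sub>R b + y) powr k))"
      using int unfolding set_lebesgue_integral_def set_integrable_def scaleR_sum_right
      by (intro Bochner_Integration.integral_sum[symmetric])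
    also have "\<dots> \<le> (LINT y:Sh|lborel. a + k * t * (y \<bullet> \<Sum>Basis))"
    proof (rule set_integral_mono)
      show "set_integrable lborel Sh (\<lambda>y. \<Sum>b\<in>Basis. norm (t *\<^sub>R b + y) powr k)"
        using int unfolding set_integrable_def scaleR_sum_right
        by (intro Bochner_Integration.integrable_sum)
    qed (use inti upper in auto)
    also have "\<dots> = (LINT y:Sh|lborel. a) + (LINT y:Sh|lborel. y \<bullet> ((k * t) *\<^sub>R \<Sum>Basis))"
      unfolding inner_scaleR_right
      by (intro set_integral_add set_integrable_continuous_bounded continuous_intros Sh)
    also have "(LINT y:Sh|lborel. y \<bullet> ((k * t) *\<^sub>R \<Sum>Basis)) = 0"
      using Sh(1) by (rule set_integral_inner_symmetric) (simp add: Sh_def)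
    also have "(LINT y:Sh|lborel. a) = unit_ball_vol ?N * (1 - (1 - \<epsilon>) ^ DIM('a)) * a"
      unfolding set_integral_const_bounded[OF Sh] unfolding Sh_def
      using \<epsilon> by (subst measure_lborel_ball_diff) auto
    finally show "(\<Sum>b\<in>(Basis :: 'a set). LINT x:(ball (t *\<^sub>R b) 1 - ball (t *\<^sub>R b) (1 - 1 / n))|lborel. norm x powr k) \<le>
       unit_ball_vol DIM('a) * (1 - (1 - 1 / n) ^ DIM('a)) *
         (DIM('a) * (1 + k / 2 * t\<^sup>2) + k * (k - 2) / 2 * t\<^sup>2 + (?N * K + 2 * \<bar>c\<bar>) * (t ^ 3 + 1 / n))"
      unfolding a_def c_def \<epsilon>_def by simp
  qed
qed

lemma power_diff_le_linear:
  fixes a b :: real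
  assumes "0 \<le> b" "b \<le> a" "a \<le> 2"
  shows "a ^ n - b ^ n \<le> n * 2 ^ n * (a - b)"
proof (induction n)
  case (Suc n)
  have "a ^ Suc n - b ^ Suc n = a * (a ^ n - b ^ n) + (a - b) * b ^ n" by (simp add: algebra_simps)
  also have "\<dots> \<le> 2 * (n * 2 ^ n * (a - b)) + (a - b) * 2 ^ Suc n"
  proof (intro add_mono mult_mono mult_left_mono)
    have "b ^ n \<le> 2 ^ n" using assms by (intro power_mono) auto
    moreover have "(0::real) \<le> 2 ^ n" by simp
    ultimately show "b ^ n \<le> 2 ^ Suc n" unfolding power_Suc by linarith
  qed (use Suc.IH assms in \<open>auto intro!: power_mono\<close>)
  also have "\<dots> = Suc n * 2 ^ Suc n * (a - b)" by (simp add: algebra_simps)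
  finally show ?case by (simp add: algebra_simps)
qed simp

text \<open>The quadratic \<open>g\<close> touches \<open>norm x powr l\<close> to first order at
  the unit sphere, and its integral over a translated ball is computed exactly. The difference
  \<open>u\<close> cancels on the common part of the two balls, which contains the origin. On the
  rest it is of order \<open>t\<^sup>2\<close>, over an annulus of volume of order \<open>t\<close>,
  so the error is of third order.\<close>

lemma ball_integral_lower:
  fixes l :: real
  assumes l: "l + real DIM('a::euclidean_space) > 0"
  obtains C where "C \<ge> 0"
    "\<And>t (e :: 'a). 0 \<le> t \<Longrightarrow> t \<le> 1/8 \<Longrightarrow> norm e = 1 \<Longrightarrow>
      DIM('a) * unit_ball_vol DIM('a) / (l + DIM('a)) + l / 2 * unit_ball_vol DIM('a) * t\<^sup>2 - C * t ^ 3 \<le>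
      (LINT x:ball (t *\<^sub>R e) 1|lborel. norm x powr l)"
proof -
  let ?N = "DIM('a)" and ?V = "unit_ball_vol (real DIM('a))"
  have V: "?V \<ge> 0" by simp
  obtain K where K: "K \<ge> 0"
    "\<And>s. \<bar>s\<bar> \<le> 3/4 \<Longrightarrow> \<bar>(1 + s) powr (l / 2) - (\<Sum>i<2. (l / 2 gchoose i) * s ^ i)\<bar> \<le> K * \<bar>s\<bar> ^ 2"
    using one_plus_powr_taylor_bound[of 2 "l / 2"] by auto
  define g where "g x = 1 + l / 2 * ((norm x)\<^sup>2 - 1)" for x :: 'a
  have taylor: "\<bar>norm x powr l - g x\<bar> \<le> 9 * K * t\<^sup>2"
    if t: "0 \<le> t" "t \<le> 1/8" and x: "1 - t \<le> norm x" "norm x \<le> 1 + t" for t and x :: 'a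
  proof -
    define s where "s = (norm x)\<^sup>2 - 1"
    have "(1 - t)\<^sup>2 \<le> (norm x)\<^sup>2" "(norm x)\<^sup>2 \<le> (1 + t)\<^sup>2" using x t by (auto intro!: power_mono)
    moreover have "(1 - t)\<^sup>2 = 1 - 2 * t + t\<^sup>2" "(1 + t)\<^sup>2 = 1 + 2 * t + t\<^sup>2"
      by (auto simp: power2_eq_square algebra_simps)
    moreover have "t\<^sup>2 \<le> t / 8" using mult_left_mono[OF t(2) t(1)] by (simp add: power2_eq_square)
    ultimately have s: "\<bar>s\<bar> \<le> 3 * t" using t zero_le_power2[of t] unfolding s_def by linarith
    then have "\<bar>(1 + s) powr (l / 2) - (1 + l / 2 * s)\<bar> \<le> K * s\<^sup>2"
      using K(2)[of s] t by (simp add: numeral_2_eq_2)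
    also have "\<dots> \<le> K * (3 * t)\<^sup>2"
      using s t K(1) by (intro mult_left_mono power2_le_iff_abs_le[THEN iffD2]) auto
    finally show ?thesis
      by (simp add: norm_powr_half[of x l] g_def s_def power_mult_distrib mult_ac)
  qed
  \<comment> \<open>Pointwise error \<open>9 * K * t\<^sup>2\<close>, from
    \<open>\<bar>s\<bar> \<le> 3 * t\<close>, times the bound
    \<open>?V * (?N * 2 ^ ?N * (2 * t))\<close> for the volume of the annulus of width
    \<open>2 * t\<close>.\<close>
  define L where "L = 9 * K * (?V * (?N * 2 ^ ?N * 2))"
  show ?thesis
  proof (rule that)
    show "L \<ge> 0" unfolding L_def using K V by simp
    fix t :: real and e :: 'a assume t: "0 \<le> t" "t \<le> 1/8" and e: "norm e = 1"
    let ?B = "ball (0::'a) 1" and ?Bt = "ball (t *\<^sub>R e) 1"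
    \<comment> \<open>contains the symmetric difference of the two balls, where \<open>|x|\<^sup>l\<close> may be replaced by \<open>g\<close>\<close>
    define D where "D = ball (0::'a) (1 + t) - ball 0 (1 - t)"
    define u where "u x = norm x powr l - g x" for x :: 'a
    have gi: "set_integrable lborel A g" if "A \<in> sets borel" "bounded A" for A
      unfolding g_def using that by (intro set_integrable_continuous_bounded continuous_intros)
    have fi: "set_integrable lborel A (\<lambda>x::'a. norm x powr l)" if "A \<in> sets borel" "bounded A" for A
      using l that by (intro set_integrable_norm_powr)
    have ui: "set_integrable lborel A u" if "A \<in> sets borel" "bounded A" for A
      unfolding u_def using that by (intro set_integral_diff gi fi)
    have D: "D \<in> sets borel" "bounded D" by (auto simp: D_def bounded_diff)
    have gm: "g \<in> borel_measurable borel" unfolding g_def by measurable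
    have split: "(LINT x:A|lborel. norm x powr l) = (LINT x:A|lborel. u x) + (LINT x:A|lborel. g x)"
      if "A \<in> sets borel" "bounded A" for A :: "'a set"
      using set_integral_add(2)[OF ui[OF that] gi[OF that]] by (simp add: u_def)
    have "(LINT x:?B|lborel. u x) - (LINT x:?Bt|lborel. u x) \<le> (LINT x:D|lborel. 9 * K * t\<^sup>2)"
    proof -
      have "(LINT x:?B|lborel. u x) - (LINT x:?Bt|lborel. u x) =
          (LINT x|lborel. indicator ?B x *\<^sub>R u x - indicator ?Bt x *\<^sub>R u x)"
        using ui[of ?B] ui[of ?Bt] unfolding set_lebesgue_integral_def set_integrable_def
        by (intro Bochner_Integration.integral_diff[symmetric]) auto
      also have "\<dots> \<le> (LINT x|lborel. indicator D x *\<^sub>R (9 * K * t\<^sup>2))"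
      proof (rule integral_mono)
        show "integrable lborel (\<lambda>x. indicator ?B x *\<^sub>R u x - indicator ?Bt x *\<^sub>R u x)"
          using ui[of ?B] ui[of ?Bt] unfolding set_integrable_def
          by (intro Bochner_Integration.integrable_diff) auto
        show "integrable lborel (\<lambda>x. indicator D x *\<^sub>R (9 * K * t\<^sup>2))"
          using set_integrable_continuous_bounded[OF continuous_on_const D, of "9 * K * t\<^sup>2"]
          by (simp add: set_integrable_def)
        fix x :: 'a
        show "indicator ?B x *\<^sub>R u x - indicator ?Bt x *\<^sub>R u x \<le> indicator D x *\<^sub>R (9 * K * t\<^sup>2)"
        proof (cases "x \<in> ?B \<longleftrightarrow> x \<in> ?Bt")
          case True
          then show ?thesis using K by (auto simp: indicator_def)
        next
          case False
          have "norm (x - t *\<^sub>R e) \<le> norm x + t" "norm x \<le> norm (x - t *\<^sub>R e) + t"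
            using norm_triangle_ineq4[of x "t *\<^sub>R e"] norm_triangle_ineq[of "x - t *\<^sub>R e" "t *\<^sub>R e"] e t by auto
          then have x: "1 - t \<le> norm x" "norm x \<le> 1 + t" "x \<in> D"
            using False t by (auto simp: D_def dist_norm norm_minus_commute)
          then show ?thesis
            using taylor[OF t x(1,2)] False by (auto simp: u_def)
        qed
      qed
      finally show ?thesis by (simp only: set_lebesgue_integral_def)
    qed
    also have "\<dots> = ?V * ((1 + t) ^ ?N - (1 - t) ^ ?N) * (9 * K * t\<^sup>2)"
      unfolding set_integral_const_bounded[OF D] unfolding D_def
      using t by (subst measure_lborel_ball_diff) auto
    also have "\<dots> \<le> ?V * (?N * 2 ^ ?N * (2 * t)) * (9 * K * t\<^sup>2)"
      using power_diff_le_linear[of "1 - t" "1 + t" ?N] t V K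
      by (intro mult_right_mono mult_left_mono) auto
    also have "\<dots> = L * t ^ 3" by (simp add: L_def power2_eq_square power3_eq_cube)
    finally have 1: "(LINT x:?B|lborel. u x) - L * t ^ 3 \<le> (LINT x:?Bt|lborel. u x)" by simp
    have "(LINT x:?Bt|lborel. g x) = (LINT y:?B|lborel. g (t *\<^sub>R e + y))"
      by (intro set_integral_translate(1) gm) (auto simp: dist_norm)
    also have "\<dots> = (LINT y:?B|lborel. g y + (l / 2 * t\<^sup>2 + y \<bullet> ((l * t) *\<^sub>R e)))"
    proof -
      have "g (t *\<^sub>R e + y) = g y + (l / 2 * t\<^sup>2 + y \<bullet> ((l * t) *\<^sub>R e))" for y
        using e unfolding g_def power2_norm_eq_inner norm_eq_1
        by (simp add: inner_add_left inner_add_right inner_commute power2_eq_square field_simps)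
      then show ?thesis by simp
    qed
    also have "\<dots> = (LINT y:?B|lborel. g y) + ((LINT y:?B|lborel. l / 2 * t\<^sup>2) + (LINT y:?B|lborel. y \<bullet> ((l * t) *\<^sub>R e)))"
      by (subst set_integral_add(2); (subst set_integral_add(2))?)
         (auto intro!: gi set_integrable_continuous_bounded continuous_intros)
    also have "(LINT y:?B|lborel. y \<bullet> ((l * t) *\<^sub>R e)) = 0"
      by (rule set_integral_inner_symmetric) auto
    also have "(LINT y:?B|lborel. l / 2 * t\<^sup>2) = ?V * (l / 2 * t\<^sup>2)"
      by (subst set_integral_const_bounded) (auto simp: measure_lborel_ball)
    finally have 2: "(LINT x:?Bt|lborel. g x) = (LINT y:?B|lborel. g y) + ?V * (l / 2 * t\<^sup>2)" by simp
    have "(LINT x:?B|lborel. norm x powr l) = ?N * ?V / (l + ?N)"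
      using integral_norm_powr_ball[of 1 l, where 'a = 'a] l by simp
    then show "?N * ?V / (l + ?N) + l / 2 * ?V * t\<^sup>2 - L * t ^ 3 \<le> (LINT x:?Bt|lborel. norm x powr l)"
      using 1 2 split[of ?B] split[of ?Bt] by (simp add: algebra_simps)
  qed
qed

text \<open>The limit is the derivative of \<open>r ^ N\<close> at 1, the ratio of the surface area
  to the volume of the unit ball.\<close>

lemma shell_volume_limit: "(\<lambda>n. real n * (1 - (1 - 1 / real n) ^ N)) \<longlonglongrightarrow> real N"
  by real_asymp

text \<open>Subtracting 1 and dividing by \<open>t\<^sup>2\<close> makes the cubic terms vanish in
  the limit, so the constants of both expansions disappear.\<close>

lemma second_order_comparison:
  fixes a b p c d :: real
  assumes "\<forall>\<^sub>F t in at_right 0. (1 + b * t\<^sup>2 - c * t ^ 3) powr p \<le> 1 + a * t\<^sup>2 + d * t ^ 3"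
  shows "p * b \<le> a"
proof (rule tendsto_le)
  show "((\<lambda>t. ((1 + b * t\<^sup>2 - c * t ^ 3) powr p - 1) / t\<^sup>2) \<longlongrightarrow> p * b) (at_right 0)"
    by real_asymp
  show "((\<lambda>t. a + d * t) \<longlongrightarrow> a) (at_right 0)"
    by real_asymp
  show "\<forall>\<^sub>F t in at_right 0. ((1 + b * t\<^sup>2 - c * t ^ 3) powr p - 1) / t\<^sup>2 \<le> a + d * t"
    using assms eventually_at_right_less[of 0]
    by eventually_elim (simp add: divide_simps power2_eq_square power3_eq_cube algebra_simps)
qed simp

section \<open>Comparison with the centred ball\<close>

lemma emeasure_mu_ball:
  fixes z :: "real ^ 'n::finite"
  assumes l: "l + real CARD('n) > 0"
  shows "emeasure (mu l) (ball z 1) = ennreal (LINT x:ball z 1|lborel. norm x powr l)"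
proof -
  have m: "(\<lambda>x::real ^ 'n. ennreal (norm x powr l)) \<in> borel_measurable lebesgue"
    by (intro measurable_completion) measurable
  have int: "integrable lborel (\<lambda>x. indicat_real (ball z 1) x * norm x powr l)"
    using set_integrable_norm_powr[of l "ball z 1"] l by (simp add: set_integrable_def)
  have "emeasure (mu l) (ball z 1) = (\<integral>\<^sup>+x. ennreal (norm x powr l) * indicator (ball z 1) x \<partial>lborel)"
    unfolding mu_def by (subst emeasure_density[OF m]) (auto simp: nn_integral_completion)
  also have "\<dots> = (\<integral>\<^sup>+x. ennreal (indicat_real (ball z 1) x * norm x powr l) \<partial>lborel)"
    by (intro nn_integral_cong) (auto split: split_indicator)
  also have "\<dots> = ennreal (LINT x:ball z 1|lborel. norm x powr l)"
    unfolding set_lebesgue_integral_def real_scaleR_def using int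
    by (intro nn_integral_eq_integral) auto
  finally show ?thesis .
qed

text \<open>The multiplied form avoids a quotient of extended reals, since the perimeter is not
  known to be finite.\<close>

lemma isoperimetric_const_le_ball:
  fixes z :: "real ^ 'n::finite" and k l :: real
  assumes l: "l + real CARD('n) > 0"
    and pos: "0 < (LINT x:ball z 1|lborel. norm x powr l)"
  shows "isoperimetric_const TYPE('n) k l *
    ereal ((LINT x:ball z 1|lborel. norm x powr l) powr ((k + real CARD('n) - 1) / (l + real CARD('n))))
    \<le> weighted_perimeter k (ball z 1)"
proof -
  have "isoperimetric_const TYPE('n) k l \<le> isoperimetric_ratio k l (ball z 1)"
    unfolding isoperimetric_const_def
    by (rule INF_lower) (use pos in \<open>auto simp: emeasure_mu_ball[OF l]\<close>)
  then have "isoperimetric_const TYPE('n) k l \<le> weighted_perimeter k (ball z 1) /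
    ereal ((LINT x:ball z 1|lborel. norm x powr l) powr ((k + real CARD('n) - 1) / (l + real CARD('n))))"
    using pos by (simp add: isoperimetric_ratio_def measure_def emeasure_mu_ball[OF l])
  then show ?thesis
    using pos by (subst (asm) ereal_le_divide_pos) (auto simp: mult.commute)
qed

text \<open>The perimeter estimate is summed over all directions \<open>b\<close>, so no second moment of a single
  coordinate is needed.\<close>

lemma small_translation_inequality:
  fixes k l t C\<^sub>k C\<^sub>l :: real
  defines "N \<equiv> real CARD('n::finite)" and "V \<equiv> unit_ball_vol (real CARD('n))"
  assumes k: "k + N - 1 > 0" and l: "l + N > 0"
    and extremal: "isoperimetric_const TYPE('n) k l = ereal (radial_const TYPE('n) k l)"
    and t: "0 \<le> t" "t \<le> 1/8"
    and upper: "\<And>n :: real. 8 \<le> n \<Longrightarrow>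
      (\<Sum>b\<in>(Basis :: (real ^ 'n) set). LINT x:(ball (t *\<^sub>R b) 1 - ball (t *\<^sub>R b) (1 - 1 / n))|lborel. norm x powr k) \<le>
       V * (1 - (1 - 1 / n) ^ CARD('n)) * (N * (1 + k / 2 * t\<^sup>2) + k * (k - 2) / 2 * t\<^sup>2 + C\<^sub>k * (t ^ 3 + 1 / n))"
    and lower: "\<And>b. b \<in> (Basis :: (real ^ 'n) set) \<Longrightarrow>
      N * V / (l + N) + l / 2 * V * t\<^sup>2 - C\<^sub>l * t ^ 3 \<le> (LINT x:ball (t *\<^sub>R b) 1|lborel. norm x powr l)"
    and h: "0 < 1 + l * (l + N) / (2 * N) * t\<^sup>2 - C\<^sub>l * (l + N) / (N * V) * t ^ 3"
  shows "(1 + l * (l + N) / (2 * N) * t\<^sup>2 - C\<^sub>l * (l + N) / (N * V) * t ^ 3) powr ((k + N - 1) / (l + N)) \<le>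
    1 + (k / 2 + k * (k - 2) / (2 * N)) * t\<^sup>2 + C\<^sub>k / N * t ^ 3"
proof -
  define p where "p = (k + N - 1) / (l + N)"
  define h where "h = 1 + l * (l + N) / (2 * N) * t\<^sup>2 - C\<^sub>l * (l + N) / (N * V) * t ^ 3"
  define A where "A = N * (1 + k / 2 * t\<^sup>2) + k * (k - 2) / 2 * t\<^sup>2"
  define m where "m b = (LINT x:ball (t *\<^sub>R b) 1|lborel. norm x powr l)" for b :: "real ^ 'n"
  have N: "N > 0" by (simp add: N_def)
  have V: "V > 0" unfolding V_def by (rule unit_ball_vol_pos) simp
  have p: "p > 0" using k l by (simp add: p_def)
  have h0: "h > 0" using h by (simp add: h_def)
  have "N * V / M * (1 + l * M / (2 * N) * t\<^sup>2 - C\<^sub>l * M / (N * V) * t ^ 3) =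
      N * V / M + l / 2 * V * t\<^sup>2 - C\<^sub>l * t ^ 3" if "M > 0" for M
    using N V that by (simp add: field_simps)
  from this[OF l] have "N * V / (l + N) * h \<le> m b" if "b \<in> Basis" for b
    using lower[OF that] unfolding h_def m_def by simp
  moreover have "0 < N * V / (l + N) * h" using N V l h0 by simp
  \<comment> \<open>Passing the lower bound for the measure through \<open>powr p\<close> uses that
    \<open>p\<close> is positive.\<close>
  ultimately have m: "0 < m b" "(N * V / (l + N) * h) powr p \<le> m b powr p" if "b \<in> Basis" for b
    using that p by (force, intro powr_mono2) (auto intro: less_imp_le)
  \<comment> \<open>With the exponents written as \<open>1 - p\<close> and \<open>p\<close>, the
    powers of \<open>N * V\<close> and \<open>l + N\<close> combine with those in the measure of the
    centred ball, leaving its perimeter \<open>N * V\<close> times \<open>h powr p\<close>.\<close>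
  have radial: "radial_const TYPE('n) k l = (N * V) powr (1 - p) * (l + N) powr p"
  proof -
    have "(l - k + 1) / (l + N) = 1 - p" using l by (simp add: p_def field_simps)
    moreover have "measure lebesgue (ball (0 :: real ^ 'n) 1) = V"
      by (simp add: measure_lborel_ball V_def)
    ultimately show ?thesis by (simp add: radial_const_def Let_def N_def p_def)
  qed
  have "radial_const TYPE('n) k l * (N * V / (l + N) * h) powr p = N * V * h powr p"
  proof -
    have "(N * V / (l + N) * h) powr p = (N * V) powr p / (l + N) powr p * h powr p"
      using N V l h0 by (simp add: powr_mult powr_divide)
    moreover have "(N * V) powr (1 - p) * (N * V) powr p = N * V"
      using N V by (simp flip: powr_add)
    ultimately show ?thesis using l by (simp add: radial)
  qed
  moreover have "0 \<le> radial_const TYPE('n) k l" by (simp add: radial)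
  ultimately have perim: "ereal (N * V * h powr p) \<le> weighted_perimeter k (ball (t *\<^sub>R b) 1)"
    if b: "b \<in> Basis" for b :: "real ^ 'n"
  proof -
    have "N * V * h powr p \<le> radial_const TYPE('n) k l * m b powr p"
      using m(2)[OF b] \<open>0 \<le> radial_const TYPE('n) k l\<close>
        \<open>radial_const TYPE('n) k l * (N * V / (l + N) * h) powr p = N * V * h powr p\<close>
      by (metis mult_left_mono)
    also have "ereal \<dots> \<le> weighted_perimeter k (ball (t *\<^sub>R b) 1)"
      using isoperimetric_const_le_ball[of l "t *\<^sub>R b" k] l m(1)[OF b]
      by (simp add: extremal m_def p_def N_def)
    finally show ?thesis by simp
  qed
  \<comment> \<open>The strict bound for the perimeter is available only below it, so an arbitrary
    smaller \<open>q\<close> is carried along and removed by density of the reals.\<close>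
  have "q \<le> V * (A + C\<^sub>k * t ^ 3)" if q: "q < N * V * h powr p" for q
  proof -
    have "\<forall>b\<in>(Basis :: (real ^ 'n) set). \<forall>\<^sub>F n in sequentially.
        q < real n * (LINT x:(ball (t *\<^sub>R b) 1 - ball (t *\<^sub>R b) (1 - 1 / real n))|lborel. norm x powr k)"
    proof (intro ballI less_weighted_perimeter_ball)
      show "0 < k + real CARD('n) - 1" using k by (simp add: N_def)
      have "ereal q < ereal (N * V * h powr p)" using q by simp
      then show "ereal q < weighted_perimeter k (ball (t *\<^sub>R b) 1)" if "b \<in> Basis" for b :: "real ^ 'n"
        using perim[OF that] by (rule less_le_trans)
    qed
    \<comment> \<open>There are finitely many directions, so one threshold for \<open>n\<close>
      serves them all.\<close>
    then have "\<forall>\<^sub>F n in sequentially. \<forall>b\<in>(Basis :: (real ^ 'n) set).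
        q < real n * (LINT x:(ball (t *\<^sub>R b) 1 - ball (t *\<^sub>R b) (1 - 1 / real n))|lborel. norm x powr k)"
      by (simp add: eventually_ball_finite)
    then have ev: "\<forall>\<^sub>F n in sequentially. N * q \<le>
        V * (real n * (1 - (1 - 1 / real n) ^ CARD('n))) * (A + C\<^sub>k * (t ^ 3 + 1 / real n))"
      using eventually_ge_at_top[of 8]
    proof eventually_elim
      case (elim n)
      have "N * q = (\<Sum>b\<in>(Basis :: (real ^ 'n) set). q)" by (simp add: N_def)
      also have "\<dots> \<le> (\<Sum>b\<in>(Basis :: (real ^ 'n) set).
          real n * (LINT x:(ball (t *\<^sub>R b) 1 - ball (t *\<^sub>R b) (1 - 1 / real n))|lborel. norm x powr k))"
        using elim(1) by (intro sum_mono) (auto intro: less_imp_le)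
      also have "\<dots> \<le> real n * (V * (1 - (1 - 1 / real n) ^ CARD('n)) * (A + C\<^sub>k * (t ^ 3 + 1 / real n)))"
        unfolding sum_distrib_left[symmetric] A_def
        using elim(2) by (intro mult_left_mono upper) auto
      finally show ?case by (simp add: mult_ac)
    qed
    \<comment> \<open>Here \<open>n\<close> tends to infinity with \<open>t\<close> fixed; the error
      \<open>1 / n\<close> disappears and the shell volumes give the factor
      \<open>V * N\<close>.\<close>
    have "(\<lambda>n. V * (real n * (1 - (1 - 1 / real n) ^ CARD('n))) * (A + C\<^sub>k * (t ^ 3 + 1 / real n)))
        \<longlonglongrightarrow> V * N * (A + C\<^sub>k * (t ^ 3 + 0))"
      unfolding N_def by (intro tendsto_intros shell_volume_limit lim_1_over_n)
    then have "N * q \<le> V * N * (A + C\<^sub>k * (t ^ 3 + 0))"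
      using ev by (rule tendsto_lowerbound) simp
    then show ?thesis using N by (simp add: mult.commute mult.left_commute)
  qed
  then have "N * V * h powr p \<le> V * (A + C\<^sub>k * t ^ 3)" by (rule dense_le)
  then have "h powr p \<le> (A + C\<^sub>k * t ^ 3) / N"
    using N V by (simp add: pos_le_divide_eq mult.commute mult.left_commute)
  also have "\<dots> = 1 + (k / 2 + k * (k - 2) / (2 * N)) * t\<^sup>2 + C\<^sub>k / N * t ^ 3"
    using N by (simp add: A_def field_simps)
  finally show ?thesis by (simp add: h_def p_def)
qed

theorem theorem4p1:
  fixes k l :: real
  assumes "k + real CARD('n::finite) - 1 > 0"
    and "l + real CARD('n) > 0"
    and "isoperimetric_const TYPE('n) k l = ereal (radial_const TYPE('n) k l)"
  shows "l + 1 \<le> k + (real CARD('n) - 1) / (k + real CARD('n) - 1)"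
proof -
  define N where "N = real CARD('n)"
  define V where "V = unit_ball_vol N"
  have N: "N > 0" by (simp add: N_def)
  have k: "k + real DIM(real ^ 'n) > 0" using assms(1) by simp
  have l: "l + real DIM(real ^ 'n) > 0" using assms(2) by simp
  obtain C\<^sub>k where "C\<^sub>k \<ge> 0" and C\<^sub>k: "\<And>t n :: real. 0 \<le> t \<Longrightarrow> t \<le> 1/8 \<Longrightarrow> 8 \<le> n \<Longrightarrow>
      (\<Sum>b\<in>(Basis :: (real ^ 'n) set). LINT x:(ball (t *\<^sub>R b) 1 - ball (t *\<^sub>R b) (1 - 1 / n))|lborel. norm x powr k) \<le>
       unit_ball_vol DIM(real ^ 'n) * (1 - (1 - 1 / n) ^ DIM(real ^ 'n)) *
         (DIM(real ^ 'n) * (1 + k / 2 * t\<^sup>2) + k * (k - 2) / 2 * t\<^sup>2 + C\<^sub>k * (t ^ 3 + 1 / n))"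
    using sum_shell_integral_upper[OF k] by blast
  obtain C\<^sub>l where "C\<^sub>l \<ge> 0" and C\<^sub>l: "\<And>t (e :: real ^ 'n). 0 \<le> t \<Longrightarrow> t \<le> 1/8 \<Longrightarrow> norm e = 1 \<Longrightarrow>
      DIM(real ^ 'n) * unit_ball_vol DIM(real ^ 'n) / (l + DIM(real ^ 'n))
        + l / 2 * unit_ball_vol DIM(real ^ 'n) * t\<^sup>2 - C\<^sub>l * t ^ 3 \<le>
      (LINT x:ball (t *\<^sub>R e) 1|lborel. norm x powr l)"
    using ball_integral_lower[OF l] by blast
  define b c where "b = l * (l + N) / (2 * N)" and "c = C\<^sub>l * (l + N) / (N * V)"
  have "((\<lambda>t. 1 + b * t\<^sup>2 - c * t ^ 3) \<longlongrightarrow> 1 + b * 0\<^sup>2 - c * 0 ^ 3) (at_right 0)"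
    by (intro tendsto_intros)
  then have "\<forall>\<^sub>F t in at_right 0. 0 < 1 + b * t\<^sup>2 - c * t ^ 3"
    by (intro order_tendstoD(1)) auto
  moreover have "\<forall>\<^sub>F t in at_right 0. t < (1/8 :: real)"
    by (rule order_tendstoD(2)[OF tendsto_ident_at]) simp
  ultimately have "\<forall>\<^sub>F t in at_right 0. (1 + b * t\<^sup>2 - c * t ^ 3) powr ((k + N - 1) / (l + N)) \<le>
      1 + (k / 2 + k * (k - 2) / (2 * N)) * t\<^sup>2 + C\<^sub>k / N * t ^ 3"
    using eventually_at_right_less[of 0]
  proof eventually_elim
    case (elim t)
    then show ?case
      using small_translation_inequality[OF assms, of t C\<^sub>k C\<^sub>l] C\<^sub>k[of t] C\<^sub>l[of t]
      by (simp add: b_def c_def N_def V_def)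
  qed
  then have "(k + N - 1) / (l + N) * b \<le> k / 2 + k * (k - 2) / (2 * N)"
    by (rule second_order_comparison)
  moreover have "(k + N - 1) / (l + N) * b = (k + N - 1) * l / (2 * N)"
    using assms(2) by (simp add: b_def N_def)
  moreover have "k / 2 + k * (k - 2) / (2 * N) = k * (k + N - 2) / (2 * N)"
    using N by (simp add: field_simps)
  ultimately have "(k + N - 1) * l \<le> k * (k + N - 2)"
    using N by (simp add: divide_le_cancel)
  \<comment> \<open>This uses
    \<open>k * (k + N - 2) = (k - 1) * (k + N - 1) + (N - 1)\<close>.\<close>
  then have "(l + 1 - k) * (k + N - 1) \<le> N - 1"
    by (simp add: algebra_simps)
  then have "l + 1 - k \<le> (N - 1) / (k + N - 1)"
    using assms(1) by (simp add: N_def pos_le_divide_eq)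
  then show ?thesis by (simp add: N_def)
qed

end
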